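(* Let $A_1,B_1,A_2,B_2>0$ and let $M\subset\mathbb C^2$ be the ellipsoid $\{A_1x_1^2+B_1y_1^2+A_2x_2^2+B_2y_2^2=1\}$, where $z_j=x_j+iy_j$. Equip $M$ with the CR structure induced from $\mathbb C^2$ and the contact form $\theta=\frac{i}{2}(\bar\partial u-\partial u)|_M$, where $u=A_1x_1^2+B_1y_1^2+A_2x_2^2+B_2y_2^2-1$. Then the Tanaka–Webster curvature $R$ of $(M,\theta)$ is strictly positive at every point of $M$.
   Context: Take $Z_1$ to be a frame of $T_{1,0}M$, $\{\theta,\theta^1,\theta^{\bar1}\}$ the coframe dual to $\{T,Z_1,Z_{\bar1}\}$ with $T$ the Reeb field of $\theta$, and $d\theta=ih_{1\bar1}\theta^1\wedge\theta^{\bar1}$ with $h_{1\bar1}>0$. The Tanaka–Webster connection form $\theta_1{}^1$ is determined by $d\theta^1=\theta^1\wedge\theta_1{}^1+\theta\wedge\tau^1$, $\tau^1\equiv0 \bmod \theta^{\bar1}$, $\theta_1{}^1+\theta_{\bar1}{}^{\bar1}=h^{1\bar1}dh_{1\bar1}$ (with $h^{1\bar1}=1/h_{1\bar1}$). The Webster curvature $R$ is defined by $d\theta_1{}^1\equiv R\,h_{1\bar1}\theta^1\wedge\theta^{\bar1}\pmod\theta$; it depends only on $(J,\theta)$ and not on the choice of frame. *)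

theory Defs
  imports "HOL-Analysis.Analysis"
begin

text \<open>Ambient space C^2 = complex \<times> complex, viewed as the real vector space R^4.
  A point is (z1, z2) with z_j = x_j + i y_j.
  A complexified (real) tangent vector v + i w (v, w real vectors in R^4) is
  represented as the pair (v, w).  Complex-valued 1-forms are represented as
  functions p \<mapsto> (real-linear map R^4 \<rightarrow> complex); they are extended
  complex-linearly to complexified vectors.  Forms on M are represented by
  ambient forms; all identities between forms on M are required only on
  (complexified) tangent vectors of M at points of M.\<close>

type_synonym pt = "complex \<times> complex"
type_synonym cvec = "pt \<times> pt"
type_synonym form1 = "pt \<Rightarrow> pt \<Rightarrow> complex"

definition ell_u :: "real \<Rightarrow> real \<Rightarrow> real \<Rightarrow> real \<Rightarrow> pt \<Rightarrow> real" where
  "ell_u A1 B1 A2 B2 p =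
     A1 * (Re (fst p))^2 + B1 * (Im (fst p))^2 + A2 * (Re (snd p))^2 + B2 * (Im (snd p))^2 - 1"

definition ellipsoid :: "real \<Rightarrow> real \<Rightarrow> real \<Rightarrow> real \<Rightarrow> pt set" where
  "ellipsoid A1 B1 A2 B2 = {p. ell_u A1 B1 A2 B2 p = 0}"

definition C1_on :: "(pt \<Rightarrow> 'b::real_normed_vector) \<Rightarrow> pt set \<Rightarrow> bool" where
  "C1_on f U \<longleftrightarrow> (\<forall>x\<in>U. f differentiable (at x)) \<and>
      (\<forall>v. continuous_on U (\<lambda>x. frechet_derivative f (at x) v))"

definition dx1 :: "(pt \<Rightarrow> real) \<Rightarrow> pt \<Rightarrow> real" where
  "dx1 f p = frechet_derivative f (at p) (1, 0)"
definition dy1 :: "(pt \<Rightarrow> real) \<Rightarrow> pt \<Rightarrow> real" where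
  "dy1 f p = frechet_derivative f (at p) (\<i>, 0)"
definition dx2 :: "(pt \<Rightarrow> real) \<Rightarrow> pt \<Rightarrow> real" where
  "dx2 f p = frechet_derivative f (at p) (0, 1)"
definition dy2 :: "(pt \<Rightarrow> real) \<Rightarrow> pt \<Rightarrow> real" where
  "dy2 f p = frechet_derivative f (at p) (0, \<i>)"

definition dz1 :: "(pt \<Rightarrow> real) \<Rightarrow> pt \<Rightarrow> complex" where
  "dz1 f p = (complex_of_real (dx1 f p) - \<i> * complex_of_real (dy1 f p)) / 2"
definition dz2 :: "(pt \<Rightarrow> real) \<Rightarrow> pt \<Rightarrow> complex" where
  "dz2 f p = (complex_of_real (dx2 f p) - \<i> * complex_of_real (dy2 f p)) / 2"
definition dzb1 :: "(pt \<Rightarrow> real) \<Rightarrow> pt \<Rightarrow> complex" where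
  "dzb1 f p = (complex_of_real (dx1 f p) + \<i> * complex_of_real (dy1 f p)) / 2"
definition dzb2 :: "(pt \<Rightarrow> real) \<Rightarrow> pt \<Rightarrow> complex" where
  "dzb2 f p = (complex_of_real (dx2 f p) + \<i> * complex_of_real (dy2 f p)) / 2"

text \<open>\<partial>f = \<Sum> f_{z_j} dz_j and \<bar>\<partial>f = \<Sum> f_{\<bar>z_j} d\<bar>z_j, as 1-forms
  (dz_j(v) = v_j, d\<bar>z_j(v) = conj v_j on real vectors v).\<close>
definition del :: "(pt \<Rightarrow> real) \<Rightarrow> form1" where
  "del f p v = dz1 f p * fst v + dz2 f p * snd v"
definition delbar :: "(pt \<Rightarrow> real) \<Rightarrow> form1" where
  "delbar f p v = dzb1 f p * cnj (fst v) + dzb2 f p * cnj (snd v)"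

definition ell_theta :: "real \<Rightarrow> real \<Rightarrow> real \<Rightarrow> real \<Rightarrow> form1" where
  "ell_theta A1 B1 A2 B2 p v =
     (\<i> / 2) * (delbar (ell_u A1 B1 A2 B2) p v - del (ell_u A1 B1 A2 B2) p v)"

definition tangent :: "(pt \<Rightarrow> real) \<Rightarrow> pt \<Rightarrow> pt \<Rightarrow> bool" where
  "tangent u p v \<longleftrightarrow> frechet_derivative u (at p) v = 0"
definition ctangent :: "(pt \<Rightarrow> real) \<Rightarrow> pt \<Rightarrow> cvec \<Rightarrow> bool" where
  "ctangent u p X \<longleftrightarrow> tangent u p (fst X) \<and> tangent u p (snd X)"

definition cconj :: "cvec \<Rightarrow> cvec" where
  "cconj X = (fst X, - snd X)"

text \<open>Type (1,0): annihilated by d\<bar>z_1 and d\<bar>z_2.\<close>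
definition type10 :: "cvec \<Rightarrow> bool" where
  "type10 X \<longleftrightarrow> cnj (fst (fst X)) + \<i> * cnj (fst (snd X)) = 0 \<and>
                 cnj (snd (fst X)) + \<i> * cnj (snd (snd X)) = 0"

definition T10 :: "(pt \<Rightarrow> real) \<Rightarrow> pt \<Rightarrow> cvec set" where
  "T10 u p = {X. ctangent u p X \<and> type10 X}"

definition capp :: "(pt \<Rightarrow> complex) \<Rightarrow> cvec \<Rightarrow> complex" where
  "capp a X = a (fst X) + \<i> * a (snd X)"
definition capp2 :: "(pt \<Rightarrow> pt \<Rightarrow> complex) \<Rightarrow> cvec \<Rightarrow> cvec \<Rightarrow> complex" where
  "capp2 b X Y = b (fst X) (fst Y) - b (snd X) (snd Y)
                 + \<i> * (b (fst X) (snd Y) + b (snd X) (fst Y))"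

definition cwedge :: "(pt \<Rightarrow> complex) \<Rightarrow> (pt \<Rightarrow> complex) \<Rightarrow> cvec \<Rightarrow> cvec \<Rightarrow> complex" where
  "cwedge a b X Y = capp a X * capp b Y - capp a Y * capp b X"

text \<open>Exterior derivative of an ambient 1-form (matching the wedge convention):
  d\<alpha>(v,w) = D_v(\<alpha>(w)) - D_w(\<alpha>(v)) for constant vectors v, w.\<close>
definition dform :: "form1 \<Rightarrow> pt \<Rightarrow> pt \<Rightarrow> pt \<Rightarrow> complex" where
  "dform \<alpha> p v w = frechet_derivative (\<lambda>x. \<alpha> x w) (at p) v
                  - frechet_derivative (\<lambda>x. \<alpha> x v) (at p) w"

definition fconj :: "form1 \<Rightarrow> form1" where
  "fconj \<alpha> p v = cnj (\<alpha> p v)"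

text \<open>Admissible data near M \<inter> U: a frame Z of T_{1,0}M, the Reeb field T of \<theta>,
  the coframe form \<theta>^1 dual to {T, Z, \<bar>Z} (with \<theta>), the function h = h_{1\<bar>1} > 0
  with d\<theta> = i h \<theta>^1\<and>\<theta>^{\<bar>1}, the Tanaka-Webster connection form \<omega> = \<theta>_1^1 and
  the torsion form \<tau>^1, satisfying the structure equations on M \<inter> U.\<close>
definition TW_data ::
  "real \<Rightarrow> real \<Rightarrow> real \<Rightarrow> real \<Rightarrow> pt set \<Rightarrow> (pt \<Rightarrow> cvec) \<Rightarrow> (pt \<Rightarrow> pt) \<Rightarrow>
   form1 \<Rightarrow> (pt \<Rightarrow> real) \<Rightarrow> form1 \<Rightarrow> form1 \<Rightarrow> bool" where
  "TW_data A1 B1 A2 B2 U Z T th1 h om tau \<longleftrightarrow>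
    (let u = ell_u A1 B1 A2 B2; th = ell_theta A1 B1 A2 B2; M = ellipsoid A1 B1 A2 B2 in
     open U \<and>
     (\<forall>v. C1_on (\<lambda>x. th1 x v) U) \<and> (\<forall>v. C1_on (\<lambda>x. om x v) U) \<and> C1_on h U \<and>
     (\<forall>q\<in>M \<inter> U.
        linear (th1 q) \<and> linear (om q) \<and> linear (tau q) \<and>
        \<comment> \<open>Z is a frame of T_{1,0}M\<close>
        Z q \<in> T10 u q \<and> Z q \<noteq> (0, 0) \<and>
        \<comment> \<open>T is the Reeb field of \<theta>\<close>
        tangent u q (T q) \<and> th q (T q) = 1 \<and>
        (\<forall>Y. ctangent u q Y \<longrightarrow> capp2 (dform th q) (T q, 0) Y = 0) \<and>
        \<comment> \<open>{\<theta>, \<theta>^1, \<theta>^{\<bar>1}} dual to {T, Z_1, Z_{\<bar>1}}\<close>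
        th1 q (T q) = 0 \<and> capp (th1 q) (Z q) = 1 \<and> capp (th1 q) (cconj (Z q)) = 0 \<and>
        \<comment> \<open>d\<theta> = i h_{1\<bar>1} \<theta>^1 \<and> \<theta>^{\<bar>1}, h_{1\<bar>1} > 0\<close>
        h q > 0 \<and>
        (\<forall>X Y. ctangent u q X \<longrightarrow> ctangent u q Y \<longrightarrow>
           capp2 (dform th q) X Y = \<i> * complex_of_real (h q) * cwedge (th1 q) (fconj th1 q) X Y) \<and>
        \<comment> \<open>d\<theta>^1 = \<theta>^1 \<and> \<theta>_1^1 + \<theta> \<and> \<tau>^1\<close>
        (\<forall>X Y. ctangent u q X \<longrightarrow> ctangent u q Y \<longrightarrow>
           capp2 (dform th1 q) X Y = cwedge (th1 q) (om q) X Y + cwedge (th q) (tau q) X Y) \<and>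
        \<comment> \<open>\<tau>^1 \<equiv> 0 mod \<theta>^{\<bar>1}\<close>
        (\<exists>a. \<forall>X. ctangent u q X \<longrightarrow> capp (tau q) X = a * capp (fconj th1 q) X) \<and>
        \<comment> \<open>\<theta>_1^1 + \<theta>_{\<bar>1}^{\<bar>1} = h^{1\<bar>1} dh_{1\<bar>1}\<close>
        (\<forall>X. ctangent u q X \<longrightarrow>
           capp (om q) X + capp (fconj om q) X =
             capp (\<lambda>v. complex_of_real (frechet_derivative h (at q) v / h q)) X)))"

text \<open>r is the Webster curvature at p computed from the data:
  d\<theta>_1^1 \<equiv> r h_{1\<bar>1} \<theta>^1 \<and> \<theta>^{\<bar>1} (mod \<theta>) at p.\<close>
definition TW_curv ::
  "real \<Rightarrow> real \<Rightarrow> real \<Rightarrow> real \<Rightarrow> form1 \<Rightarrow> (pt \<Rightarrow> real) \<Rightarrow> form1 \<Rightarrow> pt \<Rightarrow> complex \<Rightarrow> bool" where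
  "TW_curv A1 B1 A2 B2 th1 h om p r \<longleftrightarrow>
    (\<exists>\<sigma>. linear \<sigma> \<and>
      (\<forall>X Y. ctangent (ell_u A1 B1 A2 B2) p X \<longrightarrow> ctangent (ell_u A1 B1 A2 B2) p Y \<longrightarrow>
         capp2 (dform om p) X Y - r * complex_of_real (h p) * cwedge (th1 p) (fconj th1 p) X Y
           = cwedge (ell_theta A1 B1 A2 B2 p) \<sigma> X Y))"

end

theory Submission
  imports Defs
begin

text \<open>
  Put \<open>a\<^sub>j = (A\<^sub>j + B\<^sub>j) / 2\<close>, \<open>b\<^sub>j = (A\<^sub>j - B\<^sub>j) / 2\<close>, so that the coefficients
  \<open>u\<^sub>j = a\<^sub>j cnj z\<^sub>j + b\<^sub>j z\<^sub>j\<close> of \<open>\<partial>u\<close> are real-linear. With \<open>D = a\<^sub>2 |u\<^sub>1|\<^sup>2 + a\<^sub>1 |u\<^sub>2|\<^sup>2\<close> and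
  \<open>\<theta>\<^sup>1 = a\<^sub>1 cnj u\<^sub>2 dz\<^sub>1 - a\<^sub>2 cnj u\<^sub>1 dz\<^sub>2\<close> one has \<open>h = 1 / D\<close>, and the connection form is an explicit
  combination of \<open>\<theta>\<close> and \<open>cnj \<theta>\<^sup>1\<close> alone, which gives
  \<open>R = (2 a\<^sub>1 a\<^sub>2 D - a\<^sub>1 b\<^sub>2\<^sup>2 |u\<^sub>1|\<^sup>2 - a\<^sub>2 b\<^sub>1\<^sup>2 |u\<^sub>2|\<^sup>2) / D\<^sup>2 + |E|\<^sup>2 / D\<^sup>3\<close> with
  \<open>E = a\<^sub>1 b\<^sub>2 u\<^sub>2 cnj u\<^sub>1 - a\<^sub>2 b\<^sub>1 u\<^sub>1 cnj u\<^sub>2\<close>. This is positive because \<open>|b\<^sub>j| < a\<^sub>j\<close>.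
  Any other coframe is \<open>\<lambda> \<theta>\<^sup>1\<close> on the ellipsoid, with connection form changed by the closed form
  \<open>- d\<lambda> / \<lambda>\<close>. Since \<open>\<lambda>\<close> is only known to be differentiable with \<open>d\<lambda>\<close> equal to a differentiable form
  along the ellipsoid, closedness is obtained from the symmetry of second derivatives after
  pulling back along the radial retraction.
\<close>

section \<open>Forms that are exact along a quadric\<close>

text \<open>Mean value theorem in direction \<open>v\<close>, then first order expansion of
  \<open>G x v\<close> at \<open>p\<close>. Second differentiability is assumed at the single point
  \<open>p\<close>, so the result applies to forms whose coefficients are merely differentiable
  there.\<close>

lemma second_difference_quotient_tendsto:
  fixes g :: "'a::real_normed_vector \<Rightarrow> real"
  assumes "open U" "p \<in> U"
    and g: "\<And>x. x \<in> U \<Longrightarrow> (g has_derivative G x) (at x)"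
    and H: "((\<lambda>x. G x v) has_derivative H) (at p)"
  shows "((\<lambda>t. (g (p + t *\<^sub>R v + t *\<^sub>R w) - g (p + t *\<^sub>R v) - g (p + t *\<^sub>R w) + g p) / t^2)
            \<longlongrightarrow> H w) (at_right 0)"
proof (rule tendstoI)
  fix e :: real assume "e > 0"
  \<comment> \<open>The two expansion errors involve displacements of total length at most
    \<open>t * (K - 1)\<close>. The summand 1 makes \<open>K\<close> positive and the bounds by
    \<open>t * K\<close> strict; \<open>e'\<close> then leaves a total error of at most
    \<open>t * (e / 2)\<close>.\<close>
  define K where "K = 2 * norm v + norm w + 1"
  have K: "K > 0" unfolding K_def by (smt (verit) norm_ge_zero)
  define e' where "e' = e / (2 * K)"
  have e': "e' > 0" using \<open>e > 0\<close> K by (simp add: e'_def)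
  interpret H: bounded_linear H using H by (rule has_derivative_bounded_linear)
  obtain d1 where d1: "d1 > 0" "\<And>y. norm (y - p) < d1 \<Longrightarrow>
      \<bar>G y v - G p v - H (y - p)\<bar> \<le> e' * norm (y - p)"
    using H e' unfolding has_derivative_at_alt by (metis real_norm_def)
  obtain d2 where d2: "d2 > 0" "ball p d2 \<subseteq> U"
    using assms(1,2) open_contains_ball by blast
  define d where "d = min d1 d2 / K"
  have d: "d > 0" using d1(1) d2(1) K by (simp add: d_def)
  have "dist ((g (p + t *\<^sub>R v + t *\<^sub>R w) - g (p + t *\<^sub>R v) - g (p + t *\<^sub>R w) + g p) / t^2) (H w) < e"
    if t: "0 < t" "t < d" for t
  proof -
    have tK: "t * K < d1" "t * K < d2"
      using t K by (simp_all add: d_def pos_less_divide_eq)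
    have small: "norm (s *\<^sub>R v + r *\<^sub>R w) \<le> s * norm v + r * norm w"
      if "0 \<le> s" "0 \<le> r" for s r
      using norm_triangle_ineq[of "s *\<^sub>R v" "r *\<^sub>R w"] that by simp
    have small': "s * norm v + r * norm w < t * K" if "s \<le> t" "r \<le> t" for s r
    proof -
      have "s * norm v \<le> t * norm v" "r * norm w \<le> t * norm w"
        using that by (simp_all add: mult_right_mono)
      moreover have "t * norm v \<ge> 0" using t by simp
      moreover have "t * K = 2 * (t * norm v) + t * norm w + t" by (simp add: K_def algebra_simps)
      ultimately show ?thesis using t by linarith
    qed
    have inU: "p + s *\<^sub>R v + r *\<^sub>R w \<in> U" if "0 \<le> s" "0 \<le> r" "s \<le> t" "r \<le> t" for s r
    proof -
      have "norm (s *\<^sub>R v + r *\<^sub>R w) < d2"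
        using small[of s r] small'[of s r] that tK by linarith
      then show ?thesis using d2(2) by (auto simp: dist_norm subset_iff add.assoc norm_minus_commute)
    qed
    \<comment> \<open>The second difference is \<open>\<phi> t - \<phi> 0\<close>, so one
      application of the mean value theorem turns it into a difference of values of
      \<open>G _ v\<close>.\<close>
    define \<phi> where "\<phi> s = g (p + s *\<^sub>R v + t *\<^sub>R w) - g (p + s *\<^sub>R v)" for s
    have der: "DERIV \<phi> s :> G (p + s *\<^sub>R v + t *\<^sub>R w) v - G (p + s *\<^sub>R v) v"
      if s: "0 \<le> s" "s \<le> t" for s
    proof -
      have 1: "(g has_derivative G (p + s *\<^sub>R v + t *\<^sub>R w)) (at (p + s *\<^sub>R v + t *\<^sub>R w))"
        using inU[of s t] s t by (intro g) auto
      have 2: "(g has_derivative G (p + s *\<^sub>R v)) (at (p + s *\<^sub>R v))"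
        using inU[of s 0] s t by (intro g) auto
      interpret G1: bounded_linear "G (p + s *\<^sub>R v + t *\<^sub>R w)" using 1 by (rule has_derivative_bounded_linear)
      interpret G2: bounded_linear "G (p + s *\<^sub>R v)" using 2 by (rule has_derivative_bounded_linear)
      have "((\<lambda>s. g (p + s *\<^sub>R v + t *\<^sub>R w)) has_derivative (\<lambda>h. G (p + s *\<^sub>R v + t *\<^sub>R w) (h *\<^sub>R v))) (at s)"
        by (rule has_derivative_compose[where g=g and f="\<lambda>s. p + s *\<^sub>R v + t *\<^sub>R w", OF _ 1]) (auto intro!: derivative_eq_intros)
      moreover have "((\<lambda>s. g (p + s *\<^sub>R v)) has_derivative (\<lambda>h. G (p + s *\<^sub>R v) (h *\<^sub>R v))) (at s)"
        by (rule has_derivative_compose[where g=g and f="\<lambda>s. p + s *\<^sub>R v", OF _ 2]) (auto intro!: derivative_eq_intros)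
      ultimately have "(\<phi> has_derivative (\<lambda>h. G (p + s *\<^sub>R v + t *\<^sub>R w) (h *\<^sub>R v) - G (p + s *\<^sub>R v) (h *\<^sub>R v))) (at s)"
        unfolding \<phi>_def by (rule has_derivative_diff)
      then show ?thesis
        unfolding has_field_derivative_def
        by (rule has_derivative_eq_rhs) (simp add: G1.scaleR G2.scaleR fun_eq_iff right_diff_distrib mult.commute)
    qed
    obtain \<xi> where \<xi>: "0 < \<xi>" "\<xi> < t"
      and eq: "\<phi> t - \<phi> 0 = t * (G (p + \<xi> *\<^sub>R v + t *\<^sub>R w) v - G (p + \<xi> *\<^sub>R v) v)"
      using MVT2[of 0 t \<phi> "\<lambda>s. G (p + s *\<^sub>R v + t *\<^sub>R w) v - G (p + s *\<^sub>R v) v"] t der by auto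
    let ?X = "G (p + \<xi> *\<^sub>R v + t *\<^sub>R w) v - G (p + \<xi> *\<^sub>R v) v"
    have n1: "norm (\<xi> *\<^sub>R v + t *\<^sub>R w) \<le> t * norm v + t * norm w"
      using small[of \<xi> t] \<xi> t mult_right_mono[of \<xi> t "norm v"] by simp
    have n2: "norm (\<xi> *\<^sub>R v) \<le> t * norm v"
      using \<xi> mult_right_mono[of \<xi> t "norm v"] by simp
    have a1: "\<bar>G (p + \<xi> *\<^sub>R v + t *\<^sub>R w) v - G p v - H (\<xi> *\<^sub>R v + t *\<^sub>R w)\<bar> \<le> e' * norm (\<xi> *\<^sub>R v + t *\<^sub>R w)"
      using d1(2)[of "p + \<xi> *\<^sub>R v + t *\<^sub>R w"] small[of \<xi> t] small'[of \<xi> t] \<xi> t tK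
      by (simp add: add.assoc)
    have a2: "\<bar>G (p + \<xi> *\<^sub>R v) v - G p v - H (\<xi> *\<^sub>R v)\<bar> \<le> e' * norm (\<xi> *\<^sub>R v)"
      using d1(2)[of "p + \<xi> *\<^sub>R v"] small'[of \<xi> 0] \<xi> t tK by simp
    have "\<bar>?X - t * H w\<bar> \<le> e' * norm (\<xi> *\<^sub>R v + t *\<^sub>R w) + e' * norm (\<xi> *\<^sub>R v)"
      using a1 a2 by (simp add: H.add H.scaleR)
    also have "\<dots> \<le> e' * (t * norm v + t * norm w) + e' * (t * norm v)"
      using n1 n2 e' by (intro add_mono mult_left_mono) auto
    also have "\<dots> = e' * (t * (K - 1))" by (simp add: K_def algebra_simps)
    also have "\<dots> \<le> e' * (t * K)" using e' t by simp
    also have "\<dots> = t * (e / 2)" using K by (simp add: e'_def)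
    finally have X: "\<bar>?X - t * H w\<bar> \<le> t * (e / 2)" .
    have "g (p + t *\<^sub>R v + t *\<^sub>R w) - g (p + t *\<^sub>R v) - g (p + t *\<^sub>R w) + g p = t * ?X"
      using eq by (simp add: \<phi>_def)
    then have "(g (p + t *\<^sub>R v + t *\<^sub>R w) - g (p + t *\<^sub>R v) - g (p + t *\<^sub>R w) + g p) / t^2 - H w
        = t * ?X / t^2 - H w" by simp
    also have "\<dots> = (?X - t * H w) / t"
      using t by (simp add: power2_eq_square diff_divide_distrib)
    finally have "(g (p + t *\<^sub>R v + t *\<^sub>R w) - g (p + t *\<^sub>R v) - g (p + t *\<^sub>R w) + g p) / t^2 - H w
        = (?X - t * H w) / t" .
    then have "dist ((g (p + t *\<^sub>R v + t *\<^sub>R w) - g (p + t *\<^sub>R v) - g (p + t *\<^sub>R w) + g p) / t^2) (H w)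
        = \<bar>(?X - t * H w) / t\<bar>" by (simp only: dist_real_def)
    also have "\<dots> \<le> e / 2"
      using X t by (simp add: abs_divide pos_divide_le_eq mult.commute)
    also have "\<dots> < e" using \<open>e > 0\<close> by simp
    finally show ?thesis .
  qed
  then show "\<forall>\<^sub>F t in at_right 0. dist ((g (p + t *\<^sub>R v + t *\<^sub>R w) - g (p + t *\<^sub>R v) - g (p + t *\<^sub>R w) + g p) / t^2) (H w) < e"
    using d eventually_at_right_less[of 0] unfolding eventually_at_right_field by blast
qed

text \<open>Swapping \<open>v\<close> and \<open>w\<close> leaves the second difference quotient
  unchanged, and limits are unique.\<close>

lemma symmetric_second_derivative_real:
  fixes g :: "'a::real_normed_vector \<Rightarrow> real"
  assumes "open U" "p \<in> U"
    and "\<And>x. x \<in> U \<Longrightarrow> (g has_derivative G x) (at x)"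
    and "((\<lambda>x. G x v) has_derivative Hv) (at p)"
    and "((\<lambda>x. G x w) has_derivative Hw) (at p)"
  shows "Hv w = Hw v"
proof -
  have "((\<lambda>t. (g (p + t *\<^sub>R v + t *\<^sub>R w) - g (p + t *\<^sub>R v) - g (p + t *\<^sub>R w) + g p) / t^2)
            \<longlongrightarrow> Hw v) (at_right 0)"
    using second_difference_quotient_tendsto[OF assms(1-3,5), of v] by (simp add: algebra_simps)
  with second_difference_quotient_tendsto[OF assms(1-4), of w] show ?thesis
    by (intro tendsto_unique[OF trivial_limit_at_right_real])
qed

lemma symmetric_second_derivative:
  fixes g :: "'a::real_normed_vector \<Rightarrow> complex"
  assumes "open U" "p \<in> U"
    and g: "\<And>x. x \<in> U \<Longrightarrow> (g has_derivative G x) (at x)"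
    and v: "((\<lambda>x. G x v) has_derivative Hv) (at p)"
    and w: "((\<lambda>x. G x w) has_derivative Hw) (at p)"
  shows "Hv w = Hw v"
proof (rule complex_eqI)
  show "Re (Hv w) = Re (Hw v)"
    by (rule symmetric_second_derivative_real[OF assms(1,2), where g="\<lambda>x. Re (g x)" and G="\<lambda>x h. Re (G x h)"])
       (intro has_derivative_Re g v w; simp)+
  show "Im (Hv w) = Im (Hw v)"
    by (rule symmetric_second_derivative_real[OF assms(1,2), where g="\<lambda>x. Im (g x)" and G="\<lambda>x h. Im (G x h)"])
       (intro has_derivative_Im g v w; simp)+
qed

section \<open>Radial retraction onto the hypersurface \<open>B x x = 1\<close>\<close>

locale quadric =
  fixes B :: "'a::euclidean_space \<Rightarrow> 'a \<Rightarrow> real"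
  assumes bil: "bounded_bilinear B" and B_commute: "B x y = B y x"
begin

definition nrm :: "'a \<Rightarrow> real" where "nrm x = inverse (sqrt (B x x))"

definition retr :: "'a \<Rightarrow> 'a" where "retr x = nrm x *\<^sub>R x"

text \<open>The derivative of \<open>retr\<close> at \<open>x\<close>; the cube comes from
  differentiating the inverse square root in \<open>nrm\<close>.\<close>

definition dretr :: "'a \<Rightarrow> 'a \<Rightarrow> 'a" where
  "dretr x h = nrm x *\<^sub>R h - (nrm x ^ 3 * B x h) *\<^sub>R x"

lemma has_derivative_nrm:
  assumes "B x x > 0"
  shows "(nrm has_derivative (\<lambda>h. - (nrm x ^ 3) * B x h)) (at x)"
proof -
  have "((\<lambda>x. B x x) has_derivative (\<lambda>h. B x h + B h x)) (at x)"
    by (rule bounded_bilinear.FDERIV[OF bil]) (rule has_derivative_ident)+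
  then have 1: "((\<lambda>x. B x x) has_derivative (\<lambda>h. 2 * B x h)) (at x)"
    by (rule has_derivative_eq_rhs) (simp add: B_commute[of _ x])
  have 2: "((\<lambda>y. inverse (sqrt y)) has_derivative (\<lambda>k. - (inverse (sqrt (B x x)) ^ 3 / 2) * k)) (at (B x x))"
    using assms
    by (auto intro!: derivative_eq_intros simp: fun_eq_iff field_simps power3_eq_cube)
  show ?thesis
    unfolding nrm_def[abs_def]
    by (rule has_derivative_eq_rhs[OF has_derivative_compose[OF 1 2]]) (simp add: fun_eq_iff)
qed

lemma has_derivative_retr:
  assumes "B x x > 0"
  shows "(retr has_derivative dretr x) (at x)"
  unfolding retr_def[abs_def] dretr_def[abs_def]
  by (rule has_derivative_eq_rhs[OF has_derivative_scaleR[OF has_derivative_nrm[OF assms] has_derivative_ident]])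
     (simp add: fun_eq_iff)

lemma nrm_sq: "B x x > 0 \<Longrightarrow> nrm x ^ 2 * B x x = 1"
  by (simp add: nrm_def field_simps)

lemma retr_on: "B x x > 0 \<Longrightarrow> B (retr x) (retr x) = 1"
  using nrm_sq[of x] unfolding retr_def
  by (simp add: bounded_bilinear.scaleR_left[OF bil] bounded_bilinear.scaleR_right[OF bil] power2_eq_square mult.assoc)

lemma dretr_tangent: 
  assumes "B x x > 0"
  shows "B (retr x) (dretr x h) = 0"
proof -
  have "B (retr x) (dretr x h) = nrm x ^ 2 * B x h - (nrm x ^ 2 * B x x) * (nrm x ^ 2 * B x h)"
    unfolding retr_def dretr_def
    by (simp add: bounded_bilinear.scaleR_left[OF bil] bounded_bilinear.scaleR_right[OF bil]
        bounded_bilinear.diff_right[OF bil] eval_nat_numeral algebra_simps)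
  then show ?thesis using nrm_sq[OF assms] by simp
qed

lemma nrm_one: "B p p = 1 \<Longrightarrow> nrm p = 1"
  and retr_fix: "B p p = 1 \<Longrightarrow> retr p = p"
  and dretr_fix: "B p p = 1 \<Longrightarrow> B p h = 0 \<Longrightarrow> dretr p h = h"
  by (simp_all add: nrm_def retr_def dretr_def)

text \<open>On such a \<open>W\<close>, data given only on the part of the quadric inside
  \<open>U\<close> can be composed with \<open>retr\<close> to give data on an open set.\<close>

lemma nbhd_retr:
  assumes "open U" "p \<in> U" "B p p = 1"
  obtains W where "open W" "p \<in> W" "\<And>x. x \<in> W \<Longrightarrow> B x x > 0" "\<And>x. x \<in> W \<Longrightarrow> retr x \<in> U"
proof -
  let ?V = "{x. B x x > 0}"
  have contB: "continuous_on UNIV (\<lambda>x. B x x)"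
    by (intro bounded_bilinear.continuous_on[OF bil] continuous_on_id)
  have V: "open ?V"
    using open_Collect_less[OF continuous_on_const contB, of 0] by simp
  have "continuous_on ?V retr"
    using has_derivative_retr by (intro has_derivative_continuous_on) (auto intro: has_derivative_at_withinI)
  then have "open (retr -` U \<inter> ?V)" using V assms(1) continuous_on_open_vimage by blast
  then show ?thesis
    by (rule that) (use assms retr_fix in auto)
qed

text \<open>The composite of \<open>f\<close> with \<open>retr\<close> vanishes near
  \<open>p\<close>, and \<open>dretr p\<close> fixes tangent vectors.\<close>

lemma derivative_zero_of_zero_on:
  fixes f :: "'a \<Rightarrow> 'b::real_normed_vector"
  assumes U: "open U" "p \<in> U" "B p p = 1"
    and f: "(f has_derivative f') (at p)" and z: "\<And>x. x \<in> U \<Longrightarrow> B x x = 1 \<Longrightarrow> f x = 0"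
    and v: "B p v = 0"
  shows "f' v = 0"
proof -
  obtain W where W: "open W" "p \<in> W" "\<And>x. x \<in> W \<Longrightarrow> B x x > 0" "\<And>x. x \<in> W \<Longrightarrow> retr x \<in> U"
    using nbhd_retr[OF U] by blast
  have "((\<lambda>x. f (retr x)) has_derivative (\<lambda>h. f' (dretr p h))) (at p)"
    by (rule has_derivative_compose[OF has_derivative_retr]) (use U f retr_fix in auto)
  then have "((\<lambda>x. 0) has_derivative (\<lambda>h. f' (dretr p h))) (at p)"
    by (rule has_derivative_transform_within_open[OF _ W(1,2)]) (use W z retr_on in auto)
  then have "(\<lambda>h. f' (dretr p h)) = (\<lambda>h. 0)"
    using has_derivative_const has_derivative_unique by blast
  then show ?thesis using dretr_fix[OF U(3) v] by metis
qed

text \<open>Lets a form evaluated on a moving vector be differentiated by the product rule, using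
  only its values on fixed basis vectors.\<close>

lemma sum_Basis_linear:
  assumes "linear (b :: 'a \<Rightarrow> complex)"
  shows "b k = (\<Sum>e\<in>Basis. (k \<bullet> e) *\<^sub>R b e)"
proof -
  have "b k = b (\<Sum>e\<in>Basis. (k \<bullet> e) *\<^sub>R e)" by (simp add: euclidean_representation)
  then show ?thesis by (simp add: linear_sum[OF assms] linear_scale[OF assms])
qed

text \<open>Pulling \<open>\<beta>\<close> back along the radial retraction turns it into the differential of
  \<open>\<Lambda> \<circ> retr\<close> on an open set; the second derivative of \<open>retr\<close> at \<open>p\<close> is symmetric.\<close>

lemma exact_on_imp_closed:
  fixes \<Lambda> :: "'a \<Rightarrow> complex" and \<beta> :: "'a \<Rightarrow> 'a \<Rightarrow> complex"
  assumes U: "open U" "p \<in> U" "B p p = 1"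
    and lin: "\<And>x. x \<in> U \<Longrightarrow> B x x = 1 \<Longrightarrow> linear (\<beta> x)"
    and diff: "\<And>e. (\<lambda>x. \<beta> x e) differentiable (at p)"
    and exact: "\<And>x. x \<in> U \<Longrightarrow> B x x = 1 \<Longrightarrow>
        \<exists>L. (\<Lambda> has_derivative L) (at x) \<and> (\<forall>v. B x v = 0 \<longrightarrow> L v = \<beta> x v)"
    and v: "B p v = 0" and w: "B p w = 0"
  shows "frechet_derivative (\<lambda>x. \<beta> x w) (at p) v = frechet_derivative (\<lambda>x. \<beta> x v) (at p) w"
proof -
  obtain W where W: "open W" "p \<in> W" "\<And>x. x \<in> W \<Longrightarrow> B x x > 0" "\<And>x. x \<in> W \<Longrightarrow> retr x \<in> U"
    using nbhd_retr[OF U] by blast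
  have Bp: "B p p > 0" using U by simp
  define \<beta>' where "\<beta>' e = frechet_derivative (\<lambda>x. \<beta> x e) (at p)" for e
  have \<beta>': "((\<lambda>x. \<beta> x e) has_derivative \<beta>' e) (at p)" for e
    unfolding \<beta>'_def using diff by (simp add: frechet_derivative_works)
  define G where "G x h = \<beta> (retr x) (dretr x h)" for x h
  have g: "((\<lambda>x. \<Lambda> (retr x)) has_derivative G x) (at x)" if x: "x \<in> W" for x
  proof -
    obtain L where L: "(\<Lambda> has_derivative L) (at (retr x))" "\<forall>v. B (retr x) v = 0 \<longrightarrow> L v = \<beta> (retr x) v"
      using exact[OF W(4)[OF x] retr_on[OF W(3)[OF x]]] by blast
    have "((\<lambda>x. \<Lambda> (retr x)) has_derivative (\<lambda>h. L (dretr x h))) (at x)"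
      by (rule has_derivative_compose[OF has_derivative_retr[OF W(3)[OF x]] L(1)])
    then show ?thesis
      using L(2) dretr_tangent[OF W(3)[OF x]] by (simp add: G_def[abs_def])
  qed
  have main: "((\<lambda>x. G x h) has_derivative (\<lambda>k. (\<Sum>e\<in>Basis. (h \<bullet> e) *\<^sub>R \<beta>' e (dretr p k)
       + ((- B p k *\<^sub>R h - B k h *\<^sub>R p) \<bullet> e) *\<^sub>R \<beta> p e))) (at p)" if h: "B p h = 0" for h
  proof -
    \<comment> \<open>This is the second derivative of \<open>retr\<close> at \<open>p\<close>. For
      \<open>k\<close> tangent as well it reduces to \<open>- B k h *\<^sub>R p\<close>, which is
      symmetric in \<open>h\<close> and \<open>k\<close> and so cancels in the final
      comparison.\<close>
    have "((\<lambda>x. dretr x h) has_derivative (\<lambda>k. - B p k *\<^sub>R h - B k h *\<^sub>R p)) (at p)"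
      unfolding dretr_def
      by (rule derivative_eq_intros has_derivative_nrm[OF Bp] bounded_bilinear.FDERIV[OF bil] refl)+
         (simp add: h nrm_one[OF U(3)] bounded_bilinear.zero_right[OF bil] fun_eq_iff)
    note dr = has_derivative_inner_left[OF this]
    have "((\<lambda>x. \<beta> (retr x) e) has_derivative (\<lambda>k. \<beta>' e (dretr p k))) (at p)" for e
      by (rule has_derivative_compose[OF has_derivative_retr[OF Bp]]) (simp add: retr_fix[OF U(3)] \<beta>')
    then have "((\<lambda>x. \<Sum>e\<in>Basis. (dretr x h \<bullet> e) *\<^sub>R \<beta> (retr x) e) has_derivative
        (\<lambda>k. \<Sum>e\<in>Basis. (dretr p h \<bullet> e) *\<^sub>R \<beta>' e (dretr p k) 
           + ((- B p k *\<^sub>R h - B k h *\<^sub>R p) \<bullet> e) *\<^sub>R \<beta> (retr p) e)) (at p)"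
      by (intro has_derivative_sum has_derivative_scaleR dr)
    then have "((\<lambda>x. G x h) has_derivative
        (\<lambda>k. \<Sum>e\<in>Basis. (dretr p h \<bullet> e) *\<^sub>R \<beta>' e (dretr p k) 
           + ((- B p k *\<^sub>R h - B k h *\<^sub>R p) \<bullet> e) *\<^sub>R \<beta> (retr p) e)) (at p)"
    proof (rule has_derivative_transform_within_open[OF _ W(1,2)])
      fix x assume "x \<in> W"
      then have "linear (\<beta> (retr x))" using W lin retr_on by blast
      then show "(\<Sum>e\<in>Basis. (dretr x h \<bullet> e) *\<^sub>R \<beta> (retr x) e) = G x h"
        unfolding G_def by (rule sum_Basis_linear[symmetric])
    qed
    then show ?thesis by (simp add: dretr_fix[OF U(3) h] retr_fix[OF U(3)])
  qed
  \<comment> \<open>Linearity of \<open>\<beta> x\<close> is known only on the quadric, so it passes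
    to the derivative only in tangent directions \<open>k\<close>.\<close>
  have tang: "(\<Sum>e\<in>Basis. (h \<bullet> e) *\<^sub>R \<beta>' e k) = \<beta>' h k" if "B p k = 0" for h k
  proof -
    have "((\<lambda>x. (\<Sum>e\<in>Basis. (h \<bullet> e) *\<^sub>R \<beta> x e) - \<beta> x h) has_derivative
        (\<lambda>k. (\<Sum>e\<in>Basis. (h \<bullet> e) *\<^sub>R \<beta>' e k) - \<beta>' h k)) (at p)"
      by (intro has_derivative_diff has_derivative_sum has_derivative_scaleR_right \<beta>')
    from derivative_zero_of_zero_on[OF U this _ that] show ?thesis
      using sum_Basis_linear lin by fastforce
  qed
  from symmetric_second_derivative[OF W(1,2) g main[OF v] main[OF w]]
  show ?thesis
    by (simp add: v w dretr_fix[OF U(3)] tang sum.distrib sum_subtractf B_commute[of w v] flip: \<beta>'_def)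
qed

end

section \<open>Continuously differentiable functions and forms\<close>

lemma C1_onI:
  assumes "\<And>x. x \<in> U \<Longrightarrow> (f has_derivative f' x) (at x)"
    and "\<And>v. continuous_on U (\<lambda>x. f' x v)"
  shows "C1_on f U"
proof -
  have "frechet_derivative f (at x) = f' x" if "x \<in> U" for x
    using assms(1)[OF that] by (rule frechet_derivative_at[symmetric])
  then have "continuous_on U (\<lambda>x. frechet_derivative f (at x) v)" for v
    using assms(2)[of v] by (simp cong: continuous_on_cong)
  then show ?thesis
    unfolding C1_on_def differentiable_def using assms(1) by blast
qed

lemma C1_on_has_derivative:
  "C1_on f U \<Longrightarrow> x \<in> U \<Longrightarrow> (f has_derivative frechet_derivative f (at x)) (at x)"
  unfolding C1_on_def by (simp add: frechet_derivative_works)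

lemma C1_on_continuous:
  assumes "C1_on f U"
  shows "continuous_on U f"
  by (rule continuous_at_imp_continuous_on)
     (use C1_on_has_derivative[OF assms] has_derivative_continuous in blast)

lemma C1_on_const [intro]: "C1_on (\<lambda>x. c) U"
  by (rule C1_onI[where f'="\<lambda>x v. 0"]) auto

lemma C1_on_bounded_linear:
  assumes "bounded_linear L" "C1_on f U"
  shows "C1_on (\<lambda>x. L (f x)) U"
proof (rule C1_onI)
  show "((\<lambda>x. L (f x)) has_derivative (\<lambda>v. L (frechet_derivative f (at x) v))) (at x)" if "x \<in> U" for x
    using bounded_linear.has_derivative[OF assms(1) C1_on_has_derivative[OF assms(2) that]] .
  show "continuous_on U (\<lambda>x. L (frechet_derivative f (at x) v))" for v
    using assms(2) unfolding C1_on_def by (intro bounded_linear.continuous_on[OF assms(1)]) blast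
qed

lemma C1_on_linear:
  assumes "bounded_linear L"
  shows "C1_on L U"
  by (rule C1_onI[where f'="\<lambda>x. L"]) (auto intro: bounded_linear.has_derivative[OF assms] has_derivative_ident bounded_linear_imp_has_derivative assms)

lemma C1_on_continuous_derivative:
  "C1_on f U \<Longrightarrow> continuous_on U (\<lambda>x. frechet_derivative f (at x) v)"
  unfolding C1_on_def by blast

lemma C1_on_add:
  assumes "C1_on f U" "C1_on g U"
  shows "C1_on (\<lambda>x. f x + g x) U"
proof (rule C1_onI)
  show "((\<lambda>x. f x + g x) has_derivative
      (\<lambda>v. frechet_derivative f (at x) v + frechet_derivative g (at x) v)) (at x)" if "x \<in> U" for x
    by (intro has_derivative_add C1_on_has_derivative[OF _ that] assms)
qed (intro continuous_on_add C1_on_continuous_derivative assms)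

lemma C1_on_diff:
  assumes "C1_on f U" "C1_on g U"
  shows "C1_on (\<lambda>x. f x - g x) U"
proof (rule C1_onI)
  show "((\<lambda>x. f x - g x) has_derivative
      (\<lambda>v. frechet_derivative f (at x) v - frechet_derivative g (at x) v)) (at x)" if "x \<in> U" for x
    by (intro has_derivative_diff C1_on_has_derivative[OF _ that] assms)
qed (intro continuous_on_diff C1_on_continuous_derivative assms)

lemma C1_on_mult:
  fixes f g :: "pt \<Rightarrow> 'b::real_normed_algebra"
  assumes "C1_on f U" "C1_on g U"
  shows "C1_on (\<lambda>x. f x * g x) U"
proof (rule C1_onI)
  show "((\<lambda>x. f x * g x) has_derivative
      (\<lambda>v. f x * frechet_derivative g (at x) v + frechet_derivative f (at x) v * g x)) (at x)" if "x \<in> U" for x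
    by (intro has_derivative_mult C1_on_has_derivative[OF _ that] assms)
qed (intro continuous_on_add continuous_on_mult C1_on_continuous C1_on_continuous_derivative assms)

lemma C1_on_inverse:
  fixes f :: "pt \<Rightarrow> 'b::real_normed_field"
  assumes "C1_on f U" "\<And>x. x \<in> U \<Longrightarrow> f x \<noteq> 0"
  shows "C1_on (\<lambda>x. inverse (f x)) U"
proof (rule C1_onI)
  show "((\<lambda>x. inverse (f x)) has_derivative
      (\<lambda>v. - (inverse (f x) * frechet_derivative f (at x) v * inverse (f x)))) (at x)" if "x \<in> U" for x
    using assms that by (intro Deriv.has_derivative_inverse C1_on_has_derivative)
  show "continuous_on U (\<lambda>x. - (inverse (f x) * frechet_derivative f (at x) v * inverse (f x)))" for v
    using assms(2)
    by (intro continuous_on_minus continuous_on_mult continuous_on_inverse C1_on_continuous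
        C1_on_continuous_derivative assms(1)) auto
qed

section \<open>Calculus of \<open>dform\<close> and of complexified forms\<close>

lemma dform_diff:
  assumes "\<And>v. (\<lambda>x. \<alpha> x v) differentiable (at q)" "\<And>v. (\<lambda>x. \<beta> x v) differentiable (at q)"
  shows "dform (\<lambda>x v. \<alpha> x v - \<beta> x v) q v w = dform \<alpha> q v w - dform \<beta> q v w"
  unfolding dform_def
  by (simp add: frechet_derivative_at[OF has_derivative_diff[OF assms[THEN frechet_derivative_works[THEN iffD1]]], symmetric])

lemma dform_add:
  assumes "\<And>v. (\<lambda>x. \<alpha> x v) differentiable (at q)" "\<And>v. (\<lambda>x. \<beta> x v) differentiable (at q)"
  shows "dform (\<lambda>x v. \<alpha> x v + \<beta> x v) q v w = dform \<alpha> q v w + dform \<beta> q v w"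
  unfolding dform_def
  by (simp add: frechet_derivative_at[OF has_derivative_add[OF assms[THEN frechet_derivative_works[THEN iffD1]]], symmetric])

lemma dform_mult:
  assumes f: "(f has_derivative f') (at q)" and \<alpha>: "\<And>v. (\<lambda>x. \<alpha> x v) differentiable (at q)"
  shows "dform (\<lambda>x v. f x * \<alpha> x v) q v w = f' v * \<alpha> q w - f' w * \<alpha> q v + f q * dform \<alpha> q v w"
  unfolding dform_def
  by (simp add: frechet_derivative_at[OF has_derivative_mult[OF f \<alpha>[THEN frechet_derivative_works[THEN iffD1]]], symmetric]
      algebra_simps)

lemma dform_fconj:
  assumes "\<And>v. (\<lambda>x. \<alpha> x v) differentiable (at q)"
  shows "dform (fconj \<alpha>) q v w = cnj (dform \<alpha> q v w)"
  unfolding dform_def fconj_def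
  by (simp add: frechet_derivative_at[OF has_derivative_cnj[OF assms[THEN frechet_derivative_works[THEN iffD1]]], symmetric])

text \<open>The wedge of complexified forms is the complex bilinear extension of the real wedge, so
  identities between 2-forms can be checked on real vectors.\<close>

lemma cwedge_eq_capp2: "cwedge a b X Y = capp2 (\<lambda>v w. a v * b w - a w * b v) X Y"
  unfolding cwedge_def capp_def capp2_def by (simp add: algebra_simps)

lemma capp_real: "a 0 = 0 \<Longrightarrow> capp a (v, 0) = a v"
  by (simp add: capp_def)

text \<open>The values at \<open>0\<close> enter through the vanishing imaginary parts. They are
  hypotheses because \<open>b\<close> will be the \<open>dform\<close> of a form that is known to be
  linear only at points of the ellipsoid.\<close>

lemma capp2_real: "b v 0 = 0 \<Longrightarrow> b 0 w = 0 \<Longrightarrow> b 0 0 = 0 \<Longrightarrow> capp2 b (v, 0) (w, 0) = b v w"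
  by (simp add: capp2_def)

lemma cwedge_real: "a 0 = 0 \<Longrightarrow> b 0 = 0 \<Longrightarrow> cwedge a b (v, 0) (w, 0) = a v * b w - a w * b v"
  by (simp add: cwedge_def capp_real)

lemma bounded_bilinear_add:
  assumes "bounded_bilinear f" "bounded_bilinear g"
  shows "bounded_bilinear (\<lambda>x y. f x y + g x y)"
proof -
  interpret f: bounded_bilinear f by fact
  interpret g: bounded_bilinear g by fact
  obtain K L where K: "\<And>x y. norm (f x y) \<le> norm x * norm y * K"
    and L: "\<And>x y. norm (g x y) \<le> norm x * norm y * L"
    using f.bounded g.bounded by blast
  show ?thesis
  proof
    show "\<exists>K. \<forall>x y. norm (f x y + g x y) \<le> norm x * norm y * K"
    proof (intro exI allI)
      show "norm (f x y + g x y) \<le> norm x * norm y * (K + L)" for x y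
        using norm_triangle_ineq[of "f x y" "g x y"] K[of x y] L[of x y] by (simp add: distrib_left)
    qed
  qed (simp_all add: f.add_left f.add_right g.add_left g.add_right f.scaleR_left f.scaleR_right
      g.scaleR_left g.scaleR_right scaleR_add_right)
qed

section \<open>The explicit coframe\<close>

locale ell =
  fixes A1 B1 A2 B2 :: real
  assumes pos: "A1 > 0" "B1 > 0" "A2 > 0" "B2 > 0"
begin

definition a1 :: complex where "a1 = complex_of_real ((A1 + B1) / 2)"
definition a2 :: complex where "a2 = complex_of_real ((A2 + B2) / 2)"
definition b1 :: complex where "b1 = complex_of_real ((A1 - B1) / 2)"
definition b2 :: complex where "b2 = complex_of_real ((A2 - B2) / 2)"

lemma cnj_coeffs [simp]: "cnj a1 = a1" "cnj a2 = a2" "cnj b1 = b1" "cnj b2 = b2"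
  by (simp_all add: a1_def a2_def b1_def b2_def)

text \<open>\<open>u1\<close>, \<open>u2\<close> are the coefficients of \<open>\<partial>u\<close>; being real-linear, each is its own differential.\<close>

definition u1 :: "pt \<Rightarrow> complex" where "u1 q = a1 * cnj (fst q) + b1 * fst q"
definition u2 :: "pt \<Rightarrow> complex" where "u2 q = a2 * cnj (snd q) + b2 * snd q"
text \<open>This is the (1,0)-form \<open>del\<close> of the defining function. Its real part is
  half the full differential, so it vanishes on tangent vectors; its imaginary part is the contact
  form.\<close>

definition du :: "pt \<Rightarrow> pt \<Rightarrow> complex" where "du q v = u1 q * fst v + u2 q * snd v"
text \<open>Polarization of the quadratic part of the defining function; it makes the ellipsoid an
  instance of \<open>quadric\<close>.\<close>

definition Bf :: "pt \<Rightarrow> pt \<Rightarrow> real" where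
  "Bf x y = A1 * (Re (fst x) * Re (fst y)) + B1 * (Im (fst x) * Im (fst y))
          + A2 * (Re (snd x) * Re (snd y)) + B2 * (Im (snd x) * Im (snd y))"

lemma bounded_linear_u [simp]: "bounded_linear u1" "bounded_linear u2"
  unfolding u1_def[abs_def] u2_def[abs_def]
  by (auto intro!: bounded_linear_intros bounded_linear_add bounded_linear_mult_const bounded_linear_const_mult
      bounded_linear_compose[OF bounded_linear_cnj])

lemmas has_derivative_u [derivative_intros] =
  bounded_linear.has_derivative[OF bounded_linear_u(1)] bounded_linear.has_derivative[OF bounded_linear_u(2)]

lemma Bf_eq: "Bf q v = Re (du q v)"
  unfolding Bf_def du_def u1_def u2_def a1_def a2_def b1_def b2_def
  by (simp add: field_simps)

sublocale quadric Bf
proof (rule quadric.intro)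
  have "bounded_bilinear (\<lambda>x y. c * (L x * L y))" if "bounded_linear L" for c :: real and L :: "pt \<Rightarrow> real"
    using bounded_bilinear.comp[OF bounded_bilinear_mult bounded_linear_const_mult[OF that, of c] that]
    by (simp add: mult.assoc)
  note * = this[OF bounded_linear_compose[OF bounded_linear_Re bounded_linear_fst]]
    this[OF bounded_linear_compose[OF bounded_linear_Im bounded_linear_fst]]
    this[OF bounded_linear_compose[OF bounded_linear_Re bounded_linear_snd]]
    this[OF bounded_linear_compose[OF bounded_linear_Im bounded_linear_snd]]
  show "bounded_bilinear Bf"
    unfolding Bf_def[abs_def] by (intro bounded_bilinear_add *)
qed (simp add: Bf_def mult.commute)

section \<open>The ellipsoid, its tangent vectors and its contact form\<close>

lemma ell_u_eq: "ell_u A1 B1 A2 B2 q = Bf q q - 1"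
  by (simp add: ell_u_def Bf_def power2_eq_square)

lemma mem_ellipsoid: "q \<in> ellipsoid A1 B1 A2 B2 \<longleftrightarrow> Bf q q = 1"
  by (simp add: ellipsoid_def ell_u_eq)

lemma has_derivative_ell_u: "(ell_u A1 B1 A2 B2 has_derivative (\<lambda>v. 2 * Bf q v)) (at q)"
proof -
  have "((\<lambda>x. Bf x x - 1) has_derivative (\<lambda>h. (Bf q h + Bf h q) - 0)) (at q)"
    by (intro has_derivative_diff has_derivative_const bounded_bilinear.FDERIV[OF bil] has_derivative_ident)
  then show ?thesis
    by (simp add: ell_u_eq[abs_def] B_commute[of _ q])
qed

lemma frechet_ell_u: "frechet_derivative (ell_u A1 B1 A2 B2) (at q) = (\<lambda>v. 2 * Bf q v)"
  using has_derivative_ell_u by (rule frechet_derivative_at[symmetric])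

lemma tangent_iff: "tangent (ell_u A1 B1 A2 B2) q v \<longleftrightarrow> Bf q v = 0"
  by (simp add: tangent_def frechet_ell_u)

lemma dz_ell_u:
  "dz1 (ell_u A1 B1 A2 B2) q = u1 q" "dz2 (ell_u A1 B1 A2 B2) q = u2 q"
  "dzb1 (ell_u A1 B1 A2 B2) q = cnj (u1 q)" "dzb2 (ell_u A1 B1 A2 B2) q = cnj (u2 q)"
  by (simp_all add: dz1_def dz2_def dzb1_def dzb2_def dx1_def dx2_def dy1_def dy2_def frechet_ell_u
      Bf_def u1_def u2_def a1_def a2_def b1_def b2_def complex_eq_iff field_simps)

abbreviation "\<theta> \<equiv> ell_theta A1 B1 A2 B2"

lemma theta_eq: "\<theta> q v = complex_of_real (Im (du q v))"
  unfolding ell_theta_def delbar_def del_def dz_ell_u du_def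
  by (simp add: complex_eq_iff)

text \<open>Up to sign, the determinant of \<open>du q\<close> and \<open>th0 q\<close> with respect
  to the two complex coordinates; where it is nonzero, these two forms determine a vector.\<close>

definition dd :: "pt \<Rightarrow> complex" where "dd q = a2 * (u1 q * cnj (u1 q)) + a1 * (u2 q * cnj (u2 q))"

lemma dd_real: "cnj (dd q) = dd q" by (simp add: dd_def mult.commute)

lemma dd_of_real: "dd q = complex_of_real (Re (dd q))"
  using dd_real[of q] by (metis Reals_cnj_iff of_real_Re)

lemma u_eq_0: "u1 q = 0 \<longleftrightarrow> fst q = 0" "u2 q = 0 \<longleftrightarrow> snd q = 0"
  using pos by (auto simp: u1_def u2_def a1_def a2_def b1_def b2_def complex_eq_iff field_simps)

lemma Re_dd_pos: "q \<noteq> 0 \<Longrightarrow> Re (dd q) > 0"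
proof -
  assume "q \<noteq> 0"
  then have "u1 q \<noteq> 0 \<or> u2 q \<noteq> 0" by (simp add: u_eq_0 prod_eq_iff)
  moreover have "Re (dd q) = (A2 + B2) / 2 * (cmod (u1 q))^2 + (A1 + B1) / 2 * (cmod (u2 q))^2"
    unfolding dd_def a1_def a2_def complex_mult_cnj cmod_power2 by simp
  moreover have "(A2 + B2) / 2 > 0" "(A1 + B1) / 2 > 0" using pos by auto
  ultimately show ?thesis
    by (auto intro: add_pos_nonneg add_nonneg_pos)
qed

lemma dd_nz: "q \<noteq> 0 \<Longrightarrow> dd q \<noteq> 0"
  using Re_dd_pos by fastforce

section \<open>Coframe, dual real frame and connection coefficients\<close>

definition th0 :: form1 where "th0 q v = a1 * cnj (u2 q) * fst v - a2 * cnj (u1 q) * snd v"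
definition h0 :: "pt \<Rightarrow> real" where "h0 q = inverse (Re (dd q))"
text \<open>Solutions of the linear systems for \<open>du\<close> and \<open>th0\<close>:
  \<open>T0\<close>, the Reeb field on the ellipsoid, has values \<open>\<i>\<close> and 0, while
  \<open>V0\<close> has values 0 and 1. With \<open>JV0\<close>, which is \<open>\<i>\<close> times
  \<open>V0\<close>, it spans the contact plane over the reals.\<close>

definition T0 :: "pt \<Rightarrow> pt" where
  "T0 q = (\<i> * a2 * cnj (u1 q) / dd q, \<i> * a1 * cnj (u2 q) / dd q)"
definition V0 :: "pt \<Rightarrow> pt" where "V0 q = (u2 q / dd q, - u1 q / dd q)"
definition JV0 :: "pt \<Rightarrow> pt" where "JV0 q = (\<i> * (u2 q / dd q), \<i> * (- u1 q / dd q))"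
definition ee :: "pt \<Rightarrow> complex" where
  "ee q = a1 * b2 * (u2 q * cnj (u1 q)) - a2 * b1 * (u1 q * cnj (u2 q))"
definition ss :: "pt \<Rightarrow> complex" where "ss q = a2^2 * b1 * (u1 q)^2 + a1^2 * b2 * (u2 q)^2"
text \<open>\<open>ff\<close>, \<open>gg\<close> and \<open>tau_coeff\<close> are the coefficients
  of \<open>th0\<close> wedge \<open>\<theta>\<close>, \<open>th0\<close> wedge conjugate
  \<open>th0\<close>, and \<open>\<theta>\<close> wedge conjugate \<open>th0\<close> in the
  expansion of d\<open>th0\<close>. A \<open>th0\<close> term in \<open>om0\<close> would not affect
  that equation; the reality condition on \<open>om0\<close> makes its coefficient 0.\<close>

definition ff :: "pt \<Rightarrow> complex" where "ff q = \<i> * (ss q - 2 * a1 * a2 * dd q) * (inverse (dd q))^2"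
definition gg :: "pt \<Rightarrow> complex" where "gg q = ee q * (inverse (dd q))^2"
definition om0 :: form1 where "om0 q v = ff q * \<theta> q v + gg q * cnj (th0 q v)"
definition tau_coeff :: "pt \<Rightarrow> complex" where
  "tau_coeff q = \<i> * a1 * a2 * (b2 * (cnj (u1 q))^2 + b1 * (cnj (u2 q))^2) * (inverse (dd q))^2"
definition tau0 :: form1 where "tau0 q v = tau_coeff q * cnj (th0 q v)"

text \<open>On tangent vectors \<open>du q v\<close> equals \<open>\<i> * \<theta> q v\<close>, so
  Cramer's rule for \<open>du\<close> and \<open>th0\<close> recovers both coordinates of
  \<open>v\<close>.\<close>

lemma tangent_coords:
  assumes q: "q \<noteq> 0" and v: "Bf q v = 0"
  shows "fst v = (\<i> * a2 * cnj (u1 q) * \<theta> q v + u2 q * th0 q v) / dd q"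
    and "snd v = (\<i> * a1 * cnj (u2 q) * \<theta> q v - u1 q * th0 q v) / dd q"
proof -
  have "du q v = \<i> * \<theta> q v" using v unfolding Bf_eq theta_eq by (simp add: complex_eq_iff)
  then have 1: "u1 q * fst v + u2 q * snd v = \<i> * \<theta> q v" by (simp add: du_def)
  have "\<i> * a2 * cnj (u1 q) * \<theta> q v + u2 q * th0 q v = a2 * cnj (u1 q) * (\<i> * \<theta> q v) + u2 q * th0 q v" by simp
  also have "\<dots> = dd q * fst v"
    unfolding 1[symmetric] th0_def dd_def by (simp add: algebra_simps)
  finally show "fst v = (\<i> * a2 * cnj (u1 q) * \<theta> q v + u2 q * th0 q v) / dd q"
    using dd_nz[OF q] by simp
  have "\<i> * a1 * cnj (u2 q) * \<theta> q v - u1 q * th0 q v = a1 * cnj (u2 q) * (\<i> * \<theta> q v) - u1 q * th0 q v" by simp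
  also have "\<dots> = dd q * snd v"
    unfolding 1[symmetric] th0_def dd_def by (simp add: algebra_simps)
  finally show "snd v = (\<i> * a1 * cnj (u2 q) * \<theta> q v - u1 q * th0 q v) / dd q"
    using dd_nz[OF q] by simp
qed

lemma frame_values:
  assumes q: "q \<noteq> 0"
  shows "du q (T0 q) = \<i>" "du q (V0 q) = 0" "du q (JV0 q) = 0"
    "th0 q (T0 q) = 0" "th0 q (V0 q) = 1" "th0 q (JV0 q) = \<i>"
proof -
  note nz = dd_nz[OF q]
  show "du q (T0 q) = \<i>"
    using nz by (simp add: du_def T0_def divide_simps) (simp add: dd_def algebra_simps)
  show "th0 q (V0 q) = 1"
    using nz by (simp add: th0_def V0_def divide_simps) (simp add: dd_def algebra_simps)
  show "th0 q (JV0 q) = \<i>"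
    using nz by (simp add: th0_def JV0_def divide_simps) (simp add: dd_def algebra_simps)
qed (simp_all add: du_def th0_def T0_def V0_def JV0_def)

lemma frame_values':
  assumes q: "q \<noteq> 0"
  shows "Bf q (T0 q) = 0" "Bf q (V0 q) = 0" "Bf q (JV0 q) = 0"
    "\<theta> q (T0 q) = 1" "\<theta> q (V0 q) = 0" "\<theta> q (JV0 q) = 0"
  by (simp_all add: Bf_eq theta_eq frame_values[OF q])

text \<open>Reduces identities between forms along the ellipsoid to the three real frame
  vectors.\<close>

lemma tangent_decomp:
  assumes q: "q \<noteq> 0" and v: "Bf q v = 0"
  shows "v = Re (\<theta> q v) *\<^sub>R T0 q + (Re (th0 q v) *\<^sub>R V0 q + Im (th0 q v) *\<^sub>R JV0 q)"
proof -
  have 1: "complex_of_real (Re (\<theta> q v)) = \<theta> q v" by (simp add: theta_eq)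
  have 2: "complex_of_real (Re z) * x + complex_of_real (Im z) * (\<i> * x) = z * x" for x z
  proof -
    have "complex_of_real (Re z) * x + complex_of_real (Im z) * (\<i> * x)
      = (complex_of_real (Re z) + \<i> * complex_of_real (Im z)) * x" by (simp add: algebra_simps)
    then show ?thesis using complex_eq[of z] by simp
  qed
  show ?thesis
  proof (rule prod_eqI)
    show "fst v = fst (Re (\<theta> q v) *\<^sub>R T0 q + (Re (th0 q v) *\<^sub>R V0 q + Im (th0 q v) *\<^sub>R JV0 q))"
      unfolding tangent_coords(1)[OF q v] T0_def V0_def JV0_def scaleR_conv_of_real fst_add fst_scaleR fst_conv 1 2
      by (simp only: add_divide_distrib times_divide_eq_right mult_ac)
    show "snd v = snd (Re (\<theta> q v) *\<^sub>R T0 q + (Re (th0 q v) *\<^sub>R V0 q + Im (th0 q v) *\<^sub>R JV0 q))"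
      unfolding tangent_coords(2)[OF q v] T0_def V0_def JV0_def scaleR_conv_of_real snd_add snd_scaleR snd_conv 1 2
      by (simp add: diff_divide_distrib mult_ac)
  qed
qed

lemma tangent_coords_cnj:
  assumes q: "q \<noteq> 0" and v: "Bf q v = 0"
  shows "cnj (fst v) = (- \<i> * a2 * u1 q * \<theta> q v + cnj (u2 q) * cnj (th0 q v)) / dd q"
    and "cnj (snd v) = (- \<i> * a1 * u2 q * \<theta> q v - cnj (u1 q) * cnj (th0 q v)) / dd q"
proof -
  have t: "cnj (\<theta> q v) = \<theta> q v" by (simp add: theta_eq)
  show "cnj (fst v) = (- \<i> * a2 * u1 q * \<theta> q v + cnj (u2 q) * cnj (th0 q v)) / dd q"
    using arg_cong[OF tangent_coords(1)[OF q v], of cnj] by (simp add: dd_real t)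
  show "cnj (snd v) = (- \<i> * a1 * u2 q * \<theta> q v - cnj (u1 q) * cnj (th0 q v)) / dd q"
    using arg_cong[OF tangent_coords(2)[OF q v], of cnj] by (simp add: dd_real t)
qed

section \<open>Structure equations for the explicit coframe\<close>

lemma has_derivative_theta:
  "((\<lambda>x. \<theta> x w) has_derivative (\<lambda>v. complex_of_real (Im (du v w)))) (at q)"
  unfolding theta_eq du_def
  by (rule derivative_eq_intros refl bounded_linear.has_derivative[OF bounded_linear_of_real]
     bounded_linear.has_derivative[OF bounded_linear_Im])+ (simp add: fun_eq_iff)

lemma has_derivative_th0:
  "((\<lambda>x. th0 x w) has_derivative (\<lambda>v. th0 v w)) (at q)"
  unfolding th0_def
  by (rule derivative_eq_intros refl has_derivative_cnj)+ (simp add: fun_eq_iff)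

text \<open>The coefficients of \<open>\<theta>\<close> are real-linear in the base point, so its
  derivative in direction \<open>v\<close> is \<open>\<theta>\<close> based at \<open>v\<close>. The
  same holds for \<open>th0\<close>.\<close>

lemma dform_theta: "dform \<theta> q v w = \<theta> v w - \<theta> w v"
  unfolding dform_def frechet_derivative_at[OF has_derivative_theta, symmetric] by (simp add: theta_eq)

lemma dform_th0: "dform th0 q v w = th0 v w - th0 w v"
  by (simp add: dform_def frechet_derivative_at[OF has_derivative_th0, symmetric])

lemma linear_th0: "linear (th0 q)"
  by (rule linearI) (simp_all add: th0_def algebra_simps scaleR_conv_of_real)

lemma linear_theta: "linear (\<theta> q)"
  by (rule linearI) (simp_all add: theta_eq du_def algebra_simps scaleR_conv_of_real)

lemma linear_om0: "linear (om0 q)"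
  by (rule linearI) (simp_all add: om0_def linear_add[OF linear_th0] linear_add[OF linear_theta]
      linear_scale[OF linear_th0] linear_scale[OF linear_theta] algebra_simps scaleR_conv_of_real)

lemma linear_tau0: "linear (tau0 q)"
  by (rule linearI) (simp_all add: tau0_def linear_add[OF linear_th0] 
      linear_scale[OF linear_th0] algebra_simps scaleR_conv_of_real)

text \<open>Expansions in the coframe of dz1 wedge dz2, of the two mixed products of dz1 and dz2
  with conjugates, and of the Levi form, with the powers of \<open>dd q\<close> from
  \<open>tangent_coords\<close> cleared.\<close>

lemma wedge_coords:
  assumes q: "q \<noteq> 0" and v: "Bf q v = 0" and w: "Bf q w = 0"
  defines "s \<equiv> \<theta> q v" and "s' \<equiv> \<theta> q w" and "t \<equiv> th0 q v" and "t' \<equiv> th0 q w"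
  shows "dd q * (fst v * snd w - fst w * snd v) = - \<i> * (s * t' - s' * t)"
    and "(dd q)\<^sup>2 * (fst v * cnj (snd w) - fst w * cnj (snd v)) =
        - \<i> * a2 * (cnj (u1 q))\<^sup>2 * (s * cnj t' - s' * cnj t) - \<i> * a1 * (u2 q)\<^sup>2 * (t * s' - t' * s)
        - u2 q * cnj (u1 q) * (t * cnj t' - t' * cnj t)"
    and "(dd q)\<^sup>2 * (snd v * cnj (fst w) - snd w * cnj (fst v)) =
        \<i> * a1 * (cnj (u2 q))\<^sup>2 * (s * cnj t' - s' * cnj t) + \<i> * a2 * (u1 q)\<^sup>2 * (t * s' - t' * s)
        - u1 q * cnj (u2 q) * (t * cnj t' - t' * cnj t)"
    and "dd q * (a1 * (fst v * cnj (fst w) - fst w * cnj (fst v)) + a2 * (snd v * cnj (snd w) - snd w * cnj (snd v)))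
       = t * cnj t' - t' * cnj t"
proof -
  note nz = dd_nz[OF q]
  note cc = tangent_coords_cnj[OF q v] tangent_coords_cnj[OF q w]
  note c = tangent_coords[OF q v] tangent_coords[OF q w]
  have frac: "(dd q)\<^sup>2 * (x / dd q * (y / dd q) - z / dd q * (z' / dd q)) = x * y - z * z'" for x y z z'
    using nz by (simp add: field_simps power2_eq_square)
  \<comment> \<open>Two inverse factors of \<open>dd q\<close> occur, but the numerator again
    contains \<open>dd q\<close>, so one factor cancels below.\<close>
  have "(dd q)\<^sup>2 * (fst v * snd w - fst w * snd v) = dd q * (- \<i> * (s * t' - s' * t))"
    unfolding cc unfolding c frac s_def[symmetric] s'_def[symmetric] t_def[symmetric] t'_def[symmetric]
    by (simp add: dd_def algebra_simps)
  then have "dd q * (dd q * (fst v * snd w - fst w * snd v)) = dd q * (- \<i> * (s * t' - s' * t))"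
    by (simp only: power2_eq_square mult.assoc)
  then show "dd q * (fst v * snd w - fst w * snd v) = - \<i> * (s * t' - s' * t)"
    using nz by (metis mult_left_cancel)
  show "(dd q)\<^sup>2 * (fst v * cnj (snd w) - fst w * cnj (snd v)) =
        - \<i> * a2 * (cnj (u1 q))\<^sup>2 * (s * cnj t' - s' * cnj t) - \<i> * a1 * (u2 q)\<^sup>2 * (t * s' - t' * s)
        - u2 q * cnj (u1 q) * (t * cnj t' - t' * cnj t)"
    unfolding cc unfolding c frac s_def[symmetric] s'_def[symmetric] t_def[symmetric] t'_def[symmetric]
    by (simp add: algebra_simps power2_eq_square)
  show "(dd q)\<^sup>2 * (snd v * cnj (fst w) - snd w * cnj (fst v)) =
        \<i> * a1 * (cnj (u2 q))\<^sup>2 * (s * cnj t' - s' * cnj t) + \<i> * a2 * (u1 q)\<^sup>2 * (t * s' - t' * s)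
        - u1 q * cnj (u2 q) * (t * cnj t' - t' * cnj t)"
    unfolding cc unfolding c frac s_def[symmetric] s'_def[symmetric] t_def[symmetric] t'_def[symmetric]
    by (simp add: algebra_simps power2_eq_square)
  have "(dd q)\<^sup>2 * (a1 * (fst v * cnj (fst w) - fst w * cnj (fst v)) + a2 * (snd v * cnj (snd w) - snd w * cnj (snd v)))
    = a1 * ((dd q)\<^sup>2 * (fst v * cnj (fst w) - fst w * cnj (fst v))) + a2 * ((dd q)\<^sup>2 * (snd v * cnj (snd w) - snd w * cnj (snd v)))"
    by (simp add: algebra_simps)
  also have "\<dots> = dd q * (t * cnj t' - t' * cnj t)"
    unfolding cc unfolding c frac s_def[symmetric] s'_def[symmetric] t_def[symmetric] t'_def[symmetric]
    by (simp add: dd_def algebra_simps)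
  finally have "dd q * (dd q * (a1 * (fst v * cnj (fst w) - fst w * cnj (fst v)) + a2 * (snd v * cnj (snd w) - snd w * cnj (snd v))))
     = dd q * (t * cnj t' - t' * cnj t)"
    by (simp only: power2_eq_square mult.assoc)
  then show "dd q * (a1 * (fst v * cnj (fst w) - fst w * cnj (fst v)) + a2 * (snd v * cnj (snd w) - snd w * cnj (snd v)))
       = t * cnj t' - t' * cnj t"
    using nz by (metis mult_left_cancel)
qed

lemma h0_eq: "complex_of_real (h0 q) = inverse (dd q)"
  using dd_of_real[of q] by (simp add: h0_def)

text \<open>The \<open>b1\<close> and \<open>b2\<close> parts of the contact form come from the
  closed forms z dz and drop out, leaving \<open>\<i>\<close> times the Levi form with weights
  \<open>a1\<close> and \<open>a2\<close>.\<close>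

lemma dtheta_structure:
  assumes q: "q \<noteq> 0" and v: "Bf q v = 0" and w: "Bf q w = 0"
  shows "dform \<theta> q v w = \<i> * complex_of_real (h0 q) * (th0 q v * cnj (th0 q w) - th0 q w * cnj (th0 q v))"
proof -
  have "dform \<theta> q v w = \<i> * (a1 * (fst v * cnj (fst w) - fst w * cnj (fst v)) + a2 * (snd v * cnj (snd w) - snd w * cnj (snd v)))"
    unfolding dform_theta theta_eq du_def u1_def u2_def a1_def a2_def b1_def b2_def
    by (simp add: complex_eq_iff algebra_simps)
  moreover have "dd q * (a1 * (fst v * cnj (fst w) - fst w * cnj (fst v)) + a2 * (snd v * cnj (snd w) - snd w * cnj (snd v)))
       = th0 q v * cnj (th0 q w) - th0 q w * cnj (th0 q v)"
    by (rule wedge_coords(4)[OF q v w])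
  moreover have "X = inverse (dd q) * Y" if "dd q * X = Y" for X Y
    using that dd_nz[OF q] by auto
  ultimately show ?thesis
    unfolding h0_eq by (metis mult.assoc)
qed

lemma dd2_coeffs:
  assumes "q \<noteq> 0"
  shows "(dd q)\<^sup>2 * ff q = \<i> * (ss q - 2 * a1 * a2 * dd q)" "(dd q)\<^sup>2 * gg q = ee q"
    "(dd q)\<^sup>2 * tau_coeff q = \<i> * a1 * a2 * (b2 * (cnj (u1 q))^2 + b1 * (cnj (u2 q))^2)"
proof -
  have "(dd q)\<^sup>2 * (x * (inverse (dd q))\<^sup>2) = x" for x
    using dd_nz[OF assms] by (simp add: field_simps)
  then show "(dd q)\<^sup>2 * ff q = \<i> * (ss q - 2 * a1 * a2 * dd q)" "(dd q)\<^sup>2 * gg q = ee q"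
    "(dd q)\<^sup>2 * tau_coeff q = \<i> * a1 * a2 * (b2 * (cnj (u1 q))^2 + b1 * (cnj (u2 q))^2)"
    unfolding ff_def gg_def tau_coeff_def by blast+
qed

lemma dth0_structure:
  assumes q: "q \<noteq> 0" and v: "Bf q v = 0" and w: "Bf q w = 0"
  shows "dform th0 q v w = (th0 q v * om0 q w - th0 q w * om0 q v) + (\<theta> q v * tau0 q w - \<theta> q w * tau0 q v)"
proof -
  let ?s = "\<theta> q v" and ?s' = "\<theta> q w" and ?t = "th0 q v" and ?t' = "th0 q w"
  \<comment> \<open>Differentiating the coefficients of \<open>th0\<close> produces exactly the
    first three wedge products of \<open>wedge_coords\<close>; both halves contribute to dz1 wedge
    dz2, hence the factor 2.\<close>
  have "(dd q)\<^sup>2 * dform th0 q v w = - 2 * a1 * a2 * dd q * (dd q * (fst v * snd w - fst w * snd v))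
      - a1 * b2 * ((dd q)\<^sup>2 * (fst v * cnj (snd w) - fst w * cnj (snd v)))
      + a2 * b1 * ((dd q)\<^sup>2 * (snd v * cnj (fst w) - snd w * cnj (fst v)))"
    unfolding dform_th0 by (simp add: th0_def u1_def u2_def algebra_simps power2_eq_square)
  also have "\<dots> = \<i> * (ss q - 2 * a1 * a2 * dd q) * (?t * ?s' - ?t' * ?s) + ee q * (?t * cnj ?t' - ?t' * cnj ?t)
      + (\<i> * a1 * a2 * (b2 * (cnj (u1 q))^2 + b1 * (cnj (u2 q))^2)) * (?s * cnj ?t' - ?s' * cnj ?t)"
    unfolding wedge_coords[OF q v w] ss_def ee_def by (simp add: algebra_simps power2_eq_square)
  also have "\<dots> = (dd q)\<^sup>2 * (ff q * (?t * ?s' - ?t' * ?s) + gg q * (?t * cnj ?t' - ?t' * cnj ?t)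
      + tau_coeff q * (?s * cnj ?t' - ?s' * cnj ?t))"
    unfolding distrib_left mult.assoc[symmetric] dd2_coeffs[OF q] ..
  also have "\<dots> = (dd q)\<^sup>2 * ((?t * om0 q w - ?t' * om0 q v) + (?s * tau0 q w - ?s' * tau0 q v))"
    unfolding om0_def tau0_def by (simp add: algebra_simps)
  finally show ?thesis using dd_nz[OF q] by simp
qed

definition Ddd :: "pt \<Rightarrow> pt \<Rightarrow> complex" where
  "Ddd q v = a2 * (u1 v * cnj (u1 q) + u1 q * cnj (u1 v)) + a1 * (u2 v * cnj (u2 q) + u2 q * cnj (u2 v))"
definition Dee :: "pt \<Rightarrow> pt \<Rightarrow> complex" where
  "Dee q v = a1 * b2 * (u2 v * cnj (u1 q) + u2 q * cnj (u1 v)) - a2 * b1 * (u1 v * cnj (u2 q) + u1 q * cnj (u2 v))"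

lemma has_derivative_dd: "(dd has_derivative Ddd q) (at q)"
  unfolding dd_def[abs_def] Ddd_def[abs_def]
  by (rule derivative_eq_intros refl has_derivative_cnj)+ (simp add: fun_eq_iff algebra_simps)

lemma has_derivative_ee: "(ee has_derivative Dee q) (at q)"
  unfolding ee_def[abs_def] Dee_def[abs_def]
  by (rule derivative_eq_intros refl has_derivative_cnj)+ (simp add: fun_eq_iff algebra_simps)

lemma has_derivative_gg:
  assumes "q \<noteq> 0"
  shows "(gg has_derivative (\<lambda>v. Dee q v / (dd q)^2 - 2 * ee q * Ddd q v / (dd q)^3)) (at q)"
proof -
  have "((\<lambda>x. ee x * (inverse (dd x) * inverse (dd x))) has_derivative
     (\<lambda>v. Dee q v / (dd q)^2 - 2 * ee q * Ddd q v / (dd q)^3)) (at q)"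
    using dd_nz[OF assms]
    by (auto intro!: derivative_eq_intros has_derivative_ee has_derivative_dd
         simp: fun_eq_iff field_simps eval_nat_numeral)
  then show ?thesis
    by (simp add: gg_def[abs_def] power2_eq_square)
qed

lemma has_derivative_h0:
  assumes "q \<noteq> 0"
  shows "(h0 has_derivative (\<lambda>v. - Re (Ddd q v) * (h0 q)^2)) (at q)"
  unfolding h0_def[abs_def]
  using Re_dd_pos[OF assms]
  by (auto intro!: derivative_eq_intros has_derivative_dd simp: fun_eq_iff power2_eq_square)

lemma Ddd_real: "complex_of_real (Re (Ddd q v)) = Ddd q v"
  by (simp add: complex_eq_iff Ddd_def a1_def a2_def)

text \<open>Since \<open>h0\<close> is the inverse of \<open>dd\<close>, the right side is minus the
  logarithmic differential of \<open>dd\<close>. Multiplied by the square of \<open>dd q\<close>,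
  both sides are expanded in \<open>\<theta>\<close>, \<open>th0\<close> and its conjugate.\<close>

lemma om0_real_part:
  assumes q: "q \<noteq> 0" and v: "Bf q v = 0"
  shows "om0 q v + cnj (om0 q v) = complex_of_real (frechet_derivative h0 (at q) v / h0 q)"
proof -
  have nz: "dd q \<noteq> 0" by (rule dd_nz[OF q])
  have h: "h0 q \<noteq> 0" using Re_dd_pos[OF q] by (simp add: h0_def)
  have "complex_of_real (frechet_derivative h0 (at q) v / h0 q) = - complex_of_real (Re (Ddd q v)) * complex_of_real (h0 q)"
    using h by (simp add: frechet_derivative_at[OF has_derivative_h0[OF q], symmetric] power2_eq_square)
  also have "\<dots> = - Ddd q v * inverse (dd q)" by (simp only: Ddd_real h0_eq)
  finally have R: "complex_of_real (frechet_derivative h0 (at q) v / h0 q) = - Ddd q v * inverse (dd q)" .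
  have t: "cnj (\<theta> q v) = \<theta> q v" by (simp add: theta_eq)
  let ?s = "\<theta> q v" and ?t = "th0 q v"
  have "(dd q)\<^sup>2 * (om0 q v + cnj (om0 q v))
    = (dd q)\<^sup>2 * ff q * ?s + (dd q)\<^sup>2 * gg q * cnj ?t
      + cnj ((dd q)\<^sup>2 * ff q) * ?s + cnj ((dd q)\<^sup>2 * gg q) * ?t"
    unfolding om0_def by (simp add: t dd_real algebra_simps)
  also have "\<dots> = \<i> * (ss q - cnj (ss q)) * ?s + ee q * cnj ?t + cnj (ee q) * ?t"
    unfolding dd2_coeffs[OF q] by (simp add: dd_real algebra_simps)
  finally have L: "(dd q)\<^sup>2 * (om0 q v + cnj (om0 q v))
    = \<i> * (ss q - cnj (ss q)) * ?s + ee q * cnj ?t + cnj (ee q) * ?t" .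
  have canc: "dd q * (x / dd q) = x" for x using nz by simp
  \<comment> \<open>Grouping by \<open>dd q\<close> times a coordinate of \<open>v\<close> or its
    conjugate lets \<open>tangent_coords\<close> be substituted without denominators.\<close>
  have "dd q * Ddd q v = 
      b1 * (a2 * cnj (u1 q)) * (dd q * fst v) + a1 * a2 * cnj (u1 q) * (dd q * cnj (fst v))
    + b1 * (a2 * u1 q) * (dd q * cnj (fst v)) + a1 * a2 * u1 q * (dd q * fst v)
    + b2 * (a1 * cnj (u2 q)) * (dd q * snd v) + a1 * a2 * cnj (u2 q) * (dd q * cnj (snd v))
    + b2 * (a1 * u2 q) * (dd q * cnj (snd v)) + a1 * a2 * u2 q * (dd q * snd v)"
    unfolding Ddd_def u1_def[of v] u2_def[of v] by (simp add: algebra_simps)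
  also have "\<dots> = - (\<i> * (ss q - cnj (ss q)) * ?s + ee q * cnj ?t + cnj (ee q) * ?t)"
    unfolding tangent_coords_cnj[OF q v] unfolding tangent_coords[OF q v] canc ss_def ee_def
    by (simp add: algebra_simps power2_eq_square)
  finally have "(dd q)\<^sup>2 * (om0 q v + cnj (om0 q v)) = - (dd q * Ddd q v)"
    using L by simp
  also have "\<dots> = (dd q)\<^sup>2 * (- Ddd q v * inverse (dd q))"
    using nz by (simp add: field_simps power2_eq_square)
  finally have "om0 q v + cnj (om0 q v) = - Ddd q v * inverse (dd q)"
    using nz by (metis mult_left_cancel zero_eq_power2)
  then show ?thesis by (simp only: R)
qed

section \<open>Regularity of the explicit data away from the origin\<close>

lemma C1_on_u: "C1_on u1 U" "C1_on u2 U" "C1_on (\<lambda>x. cnj (u1 x)) U" "C1_on (\<lambda>x. cnj (u2 x)) U"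
  by (intro C1_on_linear C1_on_bounded_linear[OF bounded_linear_cnj] bounded_linear_u)+

lemmas C1_intros = C1_on_add C1_on_diff C1_on_mult C1_on_const C1_on_u C1_on_bounded_linear[OF bounded_linear_cnj]

lemma C1_on_th0: "C1_on (\<lambda>x. th0 x v) U"
  unfolding th0_def by (intro C1_intros)

lemma C1_on_theta: "C1_on (\<lambda>x. \<theta> x v) U"
  unfolding theta_eq du_def
  by (intro C1_on_bounded_linear[OF bounded_linear_of_real] C1_on_bounded_linear[OF bounded_linear_Im] C1_intros)

lemma C1_on_dd: "C1_on dd U"
  unfolding dd_def[abs_def] by (intro C1_intros)

lemma C1_on_inverse_dd: "C1_on (\<lambda>x. inverse (dd x)) (- {0})"
  by (intro C1_on_inverse C1_on_dd) (simp add: dd_nz)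

lemma C1_on_h0: "C1_on h0 (- {0})"
  unfolding h0_def[abs_def]
  by (intro C1_on_inverse C1_on_bounded_linear[OF bounded_linear_Re] C1_on_dd) (use Re_dd_pos in force)

lemma C1_on_ff: "C1_on ff (- {0})"
  unfolding ff_def[abs_def] ss_def power2_eq_square by (intro C1_intros C1_on_inverse_dd C1_on_dd)

lemma C1_on_gg: "C1_on gg (- {0})"
  unfolding gg_def[abs_def] ee_def power2_eq_square by (intro C1_intros C1_on_inverse_dd)

lemma C1_on_om0: "C1_on (\<lambda>x. om0 x v) (- {0})"
  unfolding om0_def by (intro C1_intros C1_on_ff C1_on_gg C1_on_theta C1_on_th0)

section \<open>The curvature function, its positivity and its origin in d\<open>om0\<close>\<close>

definition curv :: "pt \<Rightarrow> complex" where
  "curv q = (2 * a1 * a2 * dd q - a1 * b2^2 * (u1 q * cnj (u1 q)) - a2 * b1^2 * (u2 q * cnj (u2 q))) / (dd q)^2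
     + ee q * cnj (ee q) / (dd q)^3"

lemma curv_pos:
  assumes "q \<noteq> 0"
  shows "\<exists>R::real. R > 0 \<and> curv q = complex_of_real R"
proof -
  define d where "d = Re (dd q)"
  have d: "d > 0" "dd q = complex_of_real d"
    using Re_dd_pos[OF assms] dd_of_real[of q] by (simp_all add: d_def)
  define \<alpha>1 \<alpha>2 \<beta>1 \<beta>2 where "\<alpha>1 = (A1 + B1) / 2" "\<alpha>2 = (A2 + B2) / 2" "\<beta>1 = (A1 - B1) / 2" "\<beta>2 = (A2 - B2) / 2"
  note ab = this
  have c: "a1 = complex_of_real \<alpha>1" "a2 = complex_of_real \<alpha>2" "b1 = complex_of_real \<beta>1" "b2 = complex_of_real \<beta>2"
    by (simp_all add: ab a1_def a2_def b1_def b2_def)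
  define m1 m2 where "m1 = (cmod (u1 q))^2" "m2 = (cmod (u2 q))^2"
  note m = this
  have mm: "u1 q * cnj (u1 q) = complex_of_real m1" "u2 q * cnj (u2 q) = complex_of_real m2"
    by (simp_all only: m complex_norm_square)
  have m0: "m1 \<ge> 0" "m2 \<ge> 0" by (simp_all add: m)
  have dm: "d = \<alpha>2 * m1 + \<alpha>1 * m2"
  proof -
    have "complex_of_real d = complex_of_real (\<alpha>2 * m1 + \<alpha>1 * m2)"
      using d(2) unfolding dd_def mm c by simp
    then show ?thesis by (simp only: of_real_eq_iff)
  qed
  have ap: "\<alpha>1 > 0" "\<alpha>2 > 0" using pos by (simp_all add: ab)
  have sq: "\<beta>1^2 \<le> \<alpha>1^2" "\<beta>2^2 \<le> \<alpha>2^2"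
    using pos by (auto simp: ab abs_le_square_iff[symmetric])
  \<comment> \<open>One of the two copies of \<open>\<alpha>1 * \<alpha>2 * d\<close> is expanded by
    \<open>dm\<close> to absorb both negative terms; the other stays strictly positive.\<close>
  have "2 * \<alpha>1 * \<alpha>2 * d - \<alpha>1 * \<beta>2^2 * m1 - \<alpha>2 * \<beta>1^2 * m2
     = \<alpha>1 * \<alpha>2 * d + (\<alpha>1 * m1 * (\<alpha>2^2 - \<beta>2^2) + \<alpha>2 * m2 * (\<alpha>1^2 - \<beta>1^2))"
    unfolding dm by (simp add: algebra_simps power2_eq_square)
  moreover have "\<dots> > 0"
    using ap d sq m0 by (intro add_pos_nonneg add_nonneg_nonneg mult_nonneg_nonneg mult_pos_pos) auto
  ultimately have num: "2 * \<alpha>1 * \<alpha>2 * d - \<alpha>1 * \<beta>2^2 * m1 - \<alpha>2 * \<beta>1^2 * m2 > 0" by simp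
  have E: "ee q * cnj (ee q) = complex_of_real ((cmod (ee q))^2)"
    by (rule complex_norm_square[symmetric])
  define R where "R = (2 * \<alpha>1 * \<alpha>2 * d - \<alpha>1 * \<beta>2^2 * m1 - \<alpha>2 * \<beta>1^2 * m2) / d^2 + (cmod (ee q))^2 / d^3"
  have "R > 0" unfolding R_def using num d by (intro add_pos_nonneg) auto
  moreover have "curv q = complex_of_real R"
    unfolding curv_def mm R_def d(2) c E by simp
  ultimately show ?thesis by blast
qed

text \<open>On \<open>V0\<close> and \<open>JV0\<close> the form \<open>\<theta>\<close> vanishes
  and \<open>th0\<close> wedge its conjugate takes the value \<open>- 2 * \<i>\<close>, so this
  value of d\<open>om0\<close> determines the curvature, with \<open>h0\<close> being the inverse of
  \<open>dd\<close>.\<close>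

lemma dom0_frame:
  assumes q: "q \<noteq> 0"
  shows "dform om0 q (V0 q) (JV0 q) = - 2 * \<i> * curv q / dd q"
proof -
  let ?V = "V0 q" and ?W = "JV0 q"
  have nz: "dd q \<noteq> 0" by (rule dd_nz[OF q])
  note fv = frame_values[OF q] frame_values'[OF q]
  \<comment> \<open>Existence of the derivative suffices: the differential of \<open>ff\<close> is
    wedged with \<open>\<theta>\<close>, which vanishes on both vectors.\<close>
  obtain f' where f': "(ff has_derivative f') (at q)"
    using C1_on_has_derivative[OF C1_on_ff, of q] q by blast
  have dth: "(\<lambda>x. \<theta> x v) differentiable (at q)" "(\<lambda>x. th0 x v) differentiable (at q)" 
    "(\<lambda>x. fconj th0 x v) differentiable (at q)" for v
    using has_derivative_theta has_derivative_th0 has_derivative_cnj[OF has_derivative_th0]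
    unfolding differentiable_def fconj_def by blast+
  have prods: "(\<lambda>x. ff x * \<theta> x v) differentiable (at q)" "(\<lambda>x. gg x * fconj th0 x v) differentiable (at q)" for v
    using f' has_derivative_gg[OF q] by (intro differentiable_mult dth; auto simp: differentiable_def)+
  have om: "om0 = (\<lambda>x v. ff x * \<theta> x v + gg x * fconj th0 x v)"
    by (simp add: om0_def[abs_def] fconj_def)
  have dt: "dform \<theta> q ?V ?W = 2 / dd q"
    unfolding dtheta_structure[OF q fv(8,9)] fv h0_eq using nz by (simp add: field_simps)
  have dt0: "dform th0 q ?V ?W = - 2 * \<i> * gg q"
    unfolding dth0_structure[OF q fv(8,9)] fv om0_def by simp
  have u: "u1 ?V = (a1 * cnj (u2 q) + b1 * u2 q) / dd q" "u2 ?V = (- a2 * cnj (u1 q) - b2 * u1 q) / dd q"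
    "u1 ?W = \<i> * (b1 * u2 q - a1 * cnj (u2 q)) / dd q" "u2 ?W = \<i> * (a2 * cnj (u1 q) - b2 * u1 q) / dd q"
    unfolding u1_def[of ?V] u2_def[of ?V] u1_def[of ?W] u2_def[of ?W]
    unfolding V0_def JV0_def using nz by (simp_all add: dd_real field_simps)
  \<comment> \<open>Wedging a differential with the conjugate of \<open>th0\<close> on
    \<open>V0\<close> and \<open>JV0\<close> gives \<open>- \<i>\<close> times the derivative along
    \<open>V0\<close> minus \<open>\<i>\<close> times \<open>JV0\<close>, twice the (1,0) frame
    vector; hence this combination here and in \<open>E\<close>.\<close>
  have D: "dd q * (Ddd q ?V - \<i> * Ddd q ?W) = - 2 * cnj (ee q)"
    using nz unfolding Ddd_def u ee_def
    by (simp add: dd_real field_simps)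
  have E: "dd q * (Dee q ?V - \<i> * Dee q ?W)
      = 2 * (ss q - a1 * b2^2 * (u1 q * cnj (u1 q)) - a2 * b1^2 * (u2 q * cnj (u2 q)))"
    using nz unfolding Dee_def u ss_def
    by (simp add: dd_real field_simps power2_eq_square)
  let ?g = "\<lambda>v. Dee q v / (dd q)^2 - 2 * ee q * Ddd q v / (dd q)^3"
  have "dform om0 q ?V ?W = ff q * (2 / dd q) + ?g ?V * (- \<i>) - ?g ?W + gg q * cnj (- 2 * \<i> * gg q)"
    unfolding om dform_add[OF prods] dform_mult[OF f' dth(1)] dform_mult[OF has_derivative_gg[OF q] dth(3)]
      dform_fconj[OF dth(2)] dt dt0 by (simp add: fconj_def fv)
  also have "\<dots> = ff q * (2 / dd q) - \<i> * ((Dee q ?V - \<i> * Dee q ?W) / (dd q)^2 - 2 * ee q * (Ddd q ?V - \<i> * Ddd q ?W) / (dd q)^3)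
      + 2 * \<i> * (gg q * cnj (gg q))"
    by (simp add: algebra_simps diff_divide_distrib)
  also have "\<dots> = ff q * (2 / dd q) - \<i> * ((dd q * (Dee q ?V - \<i> * Dee q ?W)) / (dd q)^3 - 2 * ee q * (dd q * (Ddd q ?V - \<i> * Ddd q ?W)) / (dd q)^4)
      + 2 * \<i> * (gg q * cnj (gg q))"
    using nz by (simp add: eval_nat_numeral)
  \<comment> \<open>The \<open>ss\<close> terms from \<open>ff\<close> and from the differential of
    \<open>gg\<close> cancel, and two of the four copies of the \<open>ee\<close> square term are
    cancelled by the product of \<open>gg\<close> with its conjugate.\<close>
  also have "\<dots> = - 2 * \<i> * curv q / dd q"
    unfolding D E curv_def ff_def gg_def using nz
    by (simp add: dd_real divide_simps) (simp add: algebra_simps eval_nat_numeral)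
  finally show ?thesis .
qed

section \<open>Verification of the Tanaka-Webster data and of its curvature\<close>

lemma ctangent_iff: "ctangent (ell_u A1 B1 A2 B2) q X \<longleftrightarrow> Bf q (fst X) = 0 \<and> Bf q (snd X) = 0"
  by (simp add: ctangent_def tangent_iff)

text \<open>The real and imaginary parts of a complexified tangent vector are tangent, and
  \<open>capp2\<close> only evaluates its argument on them.\<close>

lemma capp2_tangent_eqI:
  assumes "\<And>v w. Bf q v = 0 \<Longrightarrow> Bf q w = 0 \<Longrightarrow> b v w = c v w"
    and "ctangent (ell_u A1 B1 A2 B2) q X" "ctangent (ell_u A1 B1 A2 B2) q Y"
  shows "capp2 b X Y = capp2 c X Y"
  using assms by (simp add: capp2_def ctangent_iff)

lemma Bf_zero [simp]: "Bf q 0 = 0"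
  by (simp add: Bf_def)

lemma nonzero_on: "Bf q q = 1 \<Longrightarrow> q \<noteq> 0"
  by auto

text \<open>Half of \<open>V0\<close> minus \<open>\<i>\<close> times \<open>JV0\<close>, written as
  a pair; the factor one half gives \<open>th0\<close> the value 1 on it.\<close>

definition Z0 :: "pt \<Rightarrow> cvec" where "Z0 q = ((1 / 2) *\<^sub>R V0 q, - (1 / 2) *\<^sub>R JV0 q)"

lemma TW_data_explicit: "TW_data A1 B1 A2 B2 (- {0}) Z0 T0 th0 h0 om0 tau0"
  unfolding TW_data_def Let_def
proof (intro conjI ballI allI impI)
  fix q assume "q \<in> ellipsoid A1 B1 A2 B2 \<inter> - {0}"
  then have q: "q \<noteq> 0" by simp
  note fv = frame_values[OF q] frame_values'[OF q]
  note lt = linear_scale[OF linear_th0] linear_neg[OF linear_th0] 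
  have Bs: "Bf q (c *\<^sub>R v) = c * Bf q v" for c v
    using bounded_bilinear.scaleR_right[OF bil] by simp
  show "Z0 q \<in> T10 (ell_u A1 B1 A2 B2) q"
    by (simp add: T10_def ctangent_iff Z0_def Bs fv type10_def bounded_bilinear.minus_right[OF bil])
       (simp add: V0_def JV0_def scaleR_conv_of_real)
  show "capp (th0 q) (Z0 q) = 1" "capp (th0 q) (cconj (Z0 q)) = 0"
    by (simp_all add: capp_def cconj_def Z0_def lt fv scaleR_conv_of_real)
  then show "Z0 q \<noteq> (0, 0)" by (auto simp: capp_def linear_0[OF linear_th0])
  show "tangent (ell_u A1 B1 A2 B2) q (T0 q)" by (simp add: tangent_iff fv)
  show "h0 q > 0" using Re_dd_pos[OF q] by (simp add: h0_def)
  show "capp2 (dform \<theta> q) (T0 q, 0) Y = 0" if Y: "ctangent (ell_u A1 B1 A2 B2) q Y" for Y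
    using Y by (simp add: capp2_def ctangent_iff dtheta_structure[OF q] fv linear_0[OF linear_th0])
  show "capp2 (dform \<theta> q) X Y = \<i> * complex_of_real (h0 q) * cwedge (th0 q) (fconj th0 q) X Y"
    if "ctangent (ell_u A1 B1 A2 B2) q X" "ctangent (ell_u A1 B1 A2 B2) q Y" for X Y
    using capp2_tangent_eqI[OF dtheta_structure[OF q] that]
    by (simp add: cwedge_eq_capp2) (simp add: capp2_def fconj_def algebra_simps)
  show "capp2 (dform th0 q) X Y = cwedge (th0 q) (om0 q) X Y + cwedge (\<theta> q) (tau0 q) X Y"
    if "ctangent (ell_u A1 B1 A2 B2) q X" "ctangent (ell_u A1 B1 A2 B2) q Y" for X Y
    using capp2_tangent_eqI[OF dth0_structure[OF q] that]
    by (simp add: cwedge_eq_capp2) (simp add: capp2_def algebra_simps)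
  show "\<exists>a. \<forall>X. ctangent (ell_u A1 B1 A2 B2) q X \<longrightarrow> capp (tau0 q) X = a * capp (fconj th0 q) X"
    by (rule exI[of _ "tau_coeff q"]) (simp add: capp_def tau0_def fconj_def algebra_simps)
  show "capp (om0 q) X + capp (fconj om0 q) X
      = capp (\<lambda>v. complex_of_real (frechet_derivative h0 (at q) v / h0 q)) X"
    if "ctangent (ell_u A1 B1 A2 B2) q X" for X
  proof -
    have "om0 q (fst X) + cnj (om0 q (fst X)) = complex_of_real (frechet_derivative h0 (at q) (fst X) / h0 q)"
      "om0 q (snd X) + cnj (om0 q (snd X)) = complex_of_real (frechet_derivative h0 (at q) (snd X) / h0 q)"
      using om0_real_part[OF q] that by (simp_all only: ctangent_iff)
    then show ?thesis
      unfolding capp_def fconj_def by (metis (no_types, lifting) add.assoc add.left_commute distrib_left)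
  qed
qed (simp_all add: open_Compl C1_on_th0 C1_on_om0 C1_on_h0 linear_th0 linear_om0 linear_tau0 frame_values frame_values')

text \<open>An alternating form on the three-dimensional tangent space that vanishes on the contact
  plane is \<open>\<theta>\<close> wedge its contraction with the Reeb field. This contraction of
  \<open>\<Omega>\<close> is the witness for \<open>\<sigma>\<close>.\<close>

lemma TW_curv_explicit:
  assumes p: "Bf p p = 1"
  shows "TW_curv A1 B1 A2 B2 th0 h0 om0 p (curv p)"
proof -
  have q: "p \<noteq> 0" using p by auto
  note fv = frame_values[OF q] frame_values'[OF q]
  have om: "((\<lambda>x. om0 x v) has_derivative frechet_derivative (\<lambda>x. om0 x v) (at p)) (at p)" for v
    by (rule C1_on_has_derivative[OF C1_on_om0]) (use q in simp)
  define \<Omega> where "\<Omega> v w = dform om0 p v w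
     - curv p * complex_of_real (h0 p) * (th0 p v * cnj (th0 p w) - th0 p w * cnj (th0 p v))" for v w
  have fl: "linear (frechet_derivative (\<lambda>x. om0 x v) (at p))" for v
    using om by (rule has_derivative_linear)
  have fadd: "frechet_derivative (\<lambda>x. om0 x (v + w)) (at p) k =
     frechet_derivative (\<lambda>x. om0 x v) (at p) k + frechet_derivative (\<lambda>x. om0 x w) (at p) k" for v w k
    unfolding linear_add[OF linear_om0]
    by (simp add: frechet_derivative_at[OF has_derivative_add[OF om om], symmetric])
  have fscale: "frechet_derivative (\<lambda>x. om0 x (c *\<^sub>R v)) (at p) k =
     c *\<^sub>R frechet_derivative (\<lambda>x. om0 x v) (at p) k" for c v k
    unfolding linear_scale[OF linear_om0]
    by (simp add: frechet_derivative_at[OF has_derivative_scaleR_right[OF om], symmetric])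
  note lins = linear_add[OF linear_th0] linear_scale[OF linear_th0] linear_add[OF fl] linear_scale[OF fl] fadd fscale
  have lin: "linear (\<Omega> v)" for v
    by (rule linearI) (simp_all add: \<Omega>_def dform_def lins algebra_simps scaleR_conv_of_real)
  have alt: "\<Omega> v w = - \<Omega> w v" for v w
    by (simp add: \<Omega>_def dform_def algebra_simps)
  have alt0: "\<Omega> v v = 0" for v using alt[of v v] by simp
  have "\<Omega> (V0 p) (JV0 p) = 0"
    using dd_nz[OF q] by (simp add: \<Omega>_def dom0_frame[OF q] fv h0_eq field_simps)
  then have VW: "\<Omega> (V0 p) (JV0 p) = 0" "\<Omega> (JV0 p) (V0 p) = 0" using alt[of "JV0 p" "V0 p"] by auto
  have main: "\<Omega> v w = \<theta> p v * \<Omega> (T0 p) w - \<theta> p w * \<Omega> (T0 p) v" if v: "Bf p v = 0" and w: "Bf p w = 0" for v w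
  proof -
    define s a b where "s = Re (\<theta> p v)" "a = Re (th0 p v)" "b = Im (th0 p v)"
    define s' a' b' where "s' = Re (\<theta> p w)" "a' = Re (th0 p w)" "b' = Im (th0 p w)"
    have dv: "v = s *\<^sub>R T0 p + (a *\<^sub>R V0 p + b *\<^sub>R JV0 p)" 
      using tangent_decomp[OF q v] by (simp add: s_a_b_def)
    have dw: "w = s' *\<^sub>R T0 p + (a' *\<^sub>R V0 p + b' *\<^sub>R JV0 p)" 
      using tangent_decomp[OF q w] by (simp add: s'_a'_b'_def)
    have th: "\<theta> p v = complex_of_real s" "\<theta> p w = complex_of_real s'"
      by (simp_all add: s_a_b_def s'_a'_b'_def theta_eq)
    have L: "\<Omega> x (y + z) = \<Omega> x y + \<Omega> x z" "\<Omega> x (c *\<^sub>R y) = c *\<^sub>R \<Omega> x y"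
      "\<Omega> (y + z) x = \<Omega> y x + \<Omega> z x" "\<Omega> (c *\<^sub>R y) x = c *\<^sub>R \<Omega> y x" for x y z c
      using linear_add[OF lin] linear_scale[OF lin] alt[of _ x] by (simp_all add: scaleR_minus_right)
    show ?thesis
      unfolding th unfolding dv dw L VW alt0 alt[of _ "T0 p"] scaleR_conv_of_real by (simp add: algebra_simps)
  qed
  show ?thesis
    unfolding TW_curv_def
  proof (intro exI conjI allI impI)
    show "linear (\<Omega> (T0 p))" by (rule lin)
    fix X Y assume XY: "ctangent (ell_u A1 B1 A2 B2) p X" "ctangent (ell_u A1 B1 A2 B2) p Y"
    have "capp2 \<Omega> X Y = capp2 (\<lambda>v w. \<theta> p v * \<Omega> (T0 p) w - \<theta> p w * \<Omega> (T0 p) v) X Y"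
      by (rule capp2_tangent_eqI[OF main XY])
    moreover have "capp2 \<Omega> X Y = capp2 (dform om0 p) X Y
        - curv p * complex_of_real (h0 p) * cwedge (th0 p) (fconj th0 p) X Y"
      unfolding cwedge_eq_capp2 by (simp add: capp2_def \<Omega>_def fconj_def algebra_simps)
    ultimately show "capp2 (dform om0 p) X Y - curv p * complex_of_real (h0 p) * cwedge (th0 p) (fconj th0 p) X Y
       = cwedge (\<theta> p) (\<Omega> (T0 p)) X Y"
      by (simp only: cwedge_eq_capp2)
  qed
qed

end

section \<open>Independence of the coframe\<close>

context ell
begin

text \<open>\<open>exact_on_imp_closed\<close> in terms of \<open>dform\<close>. With
  \<open>\<Lambda>\<close> zero it shows that a form vanishing along the ellipsoid has vanishing
  \<open>dform\<close> on tangent vectors.\<close>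

lemma dform_eq_0_of_exact_on:
  assumes "open U" "p \<in> U" "Bf p p = 1"
    and "\<And>x. x \<in> U \<Longrightarrow> Bf x x = 1 \<Longrightarrow> linear (\<beta> x)"
    and "\<And>e. (\<lambda>x. \<beta> x e) differentiable (at p)"
    and "\<And>x. x \<in> U \<Longrightarrow> Bf x x = 1 \<Longrightarrow> (\<Lambda> has_derivative L x) (at x)"
    and "\<And>x v. x \<in> U \<Longrightarrow> Bf x x = 1 \<Longrightarrow> Bf x v = 0 \<Longrightarrow> L x v = \<beta> x v"
    and "Bf p v = 0" "Bf p w = 0"
  shows "dform \<beta> p v w = 0"
proof -
  have "\<exists>L. (\<Lambda> has_derivative L) (at x) \<and> (\<forall>v. Bf x v = 0 \<longrightarrow> L v = \<beta> x v)"
    if "x \<in> U" "Bf x x = 1" for x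
    using assms(6,7)[OF that] by blast
  then have "frechet_derivative (\<lambda>x. \<beta> x w) (at p) v = frechet_derivative (\<lambda>x. \<beta> x v) (at p) w"
    by (intro exact_on_imp_closed[where \<Lambda>=\<Lambda> and \<beta>=\<beta> and U=U] assms(1-5,8,9))
  then show ?thesis by (simp add: dform_def)
qed

lemma linear_mult_left:
  fixes f :: "pt \<Rightarrow> complex"
  assumes "linear f"
  shows "linear (\<lambda>v. c * f v)"
  by (intro linearI; simp add: linear_add[OF assms] linear_scale[OF assms] algebra_simps)

end

section \<open>Arbitrary Tanaka-Webster data compared with the explicit coframe\<close>

locale tw = ell +
  fixes U :: "pt set" and Z :: "pt \<Rightarrow> cvec" and T :: "pt \<Rightarrow> pt" and th1 :: form1
    and h :: "pt \<Rightarrow> real" and om tau :: form1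
  assumes data: "TW_data A1 B1 A2 B2 U Z T th1 h om tau"
begin

lemma open_U: "open U"
  and C1_th1: "C1_on (\<lambda>x. th1 x v) U"
  and C1_om: "C1_on (\<lambda>x. om x v) U"
  and C1_h: "C1_on h U"
  using data unfolding TW_data_def Let_def by blast+

lemma diff_th1: "q \<in> U \<Longrightarrow> (\<lambda>x. th1 x v) differentiable (at q)"
  and diff_om: "q \<in> U \<Longrightarrow> (\<lambda>x. om x v) differentiable (at q)"
  using C1_th1 C1_om unfolding C1_on_def by blast+

lemma pointwise:
  assumes "q \<in> U" "Bf q q = 1"
  shows linear_th1: "linear (th1 q)" and linear_om: "linear (om q)" and linear_tau: "linear (tau q)"
    and Z_T10: "Z q \<in> T10 (ell_u A1 B1 A2 B2) q"
    and th1_Z: "capp (th1 q) (Z q) = 1" "capp (th1 q) (cconj (Z q)) = 0"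
    and h_pos: "h q > 0"
    and dtheta_eq: "\<And>X Y. ctangent (ell_u A1 B1 A2 B2) q X \<Longrightarrow> ctangent (ell_u A1 B1 A2 B2) q Y \<Longrightarrow>
           capp2 (dform \<theta> q) X Y = \<i> * complex_of_real (h q) * cwedge (th1 q) (fconj th1 q) X Y"
    and dth1_eq: "\<And>X Y. ctangent (ell_u A1 B1 A2 B2) q X \<Longrightarrow> ctangent (ell_u A1 B1 A2 B2) q Y \<Longrightarrow>
           capp2 (dform th1 q) X Y = cwedge (th1 q) (om q) X Y + cwedge (\<theta> q) (tau q) X Y"
    and tau_eq: "\<exists>a. \<forall>X. ctangent (ell_u A1 B1 A2 B2) q X \<longrightarrow> capp (tau q) X = a * capp (fconj th1 q) X"
    and om_eq: "\<And>X. ctangent (ell_u A1 B1 A2 B2) q X \<Longrightarrow>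
           capp (om q) X + capp (fconj om q) X =
             capp (\<lambda>v. complex_of_real (frechet_derivative h (at q) v / h q)) X"
proof -
  have "q \<in> ellipsoid A1 B1 A2 B2 \<inter> U" using assms by (simp add: mem_ellipsoid)
  then show "linear (th1 q)" "linear (om q)" "linear (tau q)"
    "Z q \<in> T10 (ell_u A1 B1 A2 B2) q" "capp (th1 q) (Z q) = 1" "capp (th1 q) (cconj (Z q)) = 0" "h q > 0"
    "\<And>X Y. ctangent (ell_u A1 B1 A2 B2) q X \<Longrightarrow> ctangent (ell_u A1 B1 A2 B2) q Y \<Longrightarrow>
           capp2 (dform \<theta> q) X Y = \<i> * complex_of_real (h q) * cwedge (th1 q) (fconj th1 q) X Y"
    "\<And>X Y. ctangent (ell_u A1 B1 A2 B2) q X \<Longrightarrow> ctangent (ell_u A1 B1 A2 B2) q Y \<Longrightarrow>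
           capp2 (dform th1 q) X Y = cwedge (th1 q) (om q) X Y + cwedge (\<theta> q) (tau q) X Y"
    "\<exists>a. \<forall>X. ctangent (ell_u A1 B1 A2 B2) q X \<longrightarrow> capp (tau q) X = a * capp (fconj th1 q) X"
    "\<And>X. ctangent (ell_u A1 B1 A2 B2) q X \<Longrightarrow>
           capp (om q) X + capp (fconj om q) X =
             capp (\<lambda>v. complex_of_real (frechet_derivative h (at q) v / h q)) X"
    using data unfolding TW_data_def Let_def by blast+
qed

lemma ctangent_real: "Bf q v = 0 \<Longrightarrow> ctangent (ell_u A1 B1 A2 B2) q (v, 0)"
  by (simp add: ctangent_iff)

text \<open>\<open>Z q\<close> is \<open>t\<close> times \<open>V0\<close> minus \<open>\<i>\<close>
  times \<open>JV0\<close> in the complexification. Duality of \<open>th1\<close> with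
  \<open>Z\<close> and its conjugate therefore forces complex linearity and nonvanishing on the
  contact plane.\<close>

lemma th1_horizontal:
  assumes q: "q \<in> U" "Bf q q = 1"
  shows "th1 q (JV0 q) = \<i> * th1 q (V0 q)" "th1 q (V0 q) \<noteq> 0"
proof -
  have q0: "q \<noteq> 0" by (rule nonzero_on[OF q(2)])
  obtain v v' where Z: "Z q = (v, v')" by (cases "Z q")
  have cd: "b = - \<i> * a" if "cnj a + \<i> * cnj b = 0" for a b
    using that by (auto simp: complex_eq_iff)
  have v': "fst v' = - \<i> * fst v" "snd v' = - \<i> * snd v"
    using Z_T10[OF q] cd by (auto simp: T10_def type10_def Z)
  have B: "Bf q v = 0" "Bf q v' = 0"
    using Z_T10[OF q] by (simp_all add: T10_def ctangent_iff Z)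
  define t where "t = th0 q v"
  have du': "du q v' = - \<i> * du q v" by (simp add: du_def v' algebra_simps)
  have t': "th0 q v' = - \<i> * t" by (simp add: th0_def v' t_def algebra_simps)
  \<comment> \<open>Tangency of \<open>v\<close> and \<open>v'\<close> kills the real parts of both
    \<open>du q v\<close> and \<open>- \<i> * du q v\<close>, so \<open>du q v\<close> itself is
    zero.\<close>
  have "\<theta> q v = 0" "\<theta> q v' = 0"
    using B unfolding Bf_eq du' theta_eq by (simp_all add: du')
  then have dv: "v = Re t *\<^sub>R V0 q + Im t *\<^sub>R JV0 q" "v' = Im t *\<^sub>R V0 q - Re t *\<^sub>R JV0 q"
    using tangent_decomp[OF q0 B(1)] tangent_decomp[OF q0 B(2)] unfolding t' by (simp_all add: t_def)
  note L = linear_add[OF linear_th1[OF q]] linear_diff[OF linear_th1[OF q]] linear_scale[OF linear_th1[OF q]]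
    linear_neg[OF linear_th1[OF q]]
  let ?A = "th1 q (V0 q)" and ?J = "th1 q (JV0 q)"
  have e: "th1 q v = of_real (Re t) * ?A + of_real (Im t) * ?J" "th1 q v' = of_real (Im t) * ?A - of_real (Re t) * ?J"
    unfolding dv L scaleR_conv_of_real by simp_all
  have t: "t = of_real (Re t) + \<i> * of_real (Im t)" "cnj t = of_real (Re t) - \<i> * of_real (Im t)"
    by (simp_all add: complex_eq_iff)
  have 1: "th1 q v + \<i> * th1 q v' = 1" "th1 q v - \<i> * th1 q v' = 0"
    using th1_Z[OF q] by (simp_all add: Z capp_def cconj_def L)
  have "cnj t * (?A + \<i> * ?J) = th1 q v - \<i> * th1 q v'"
    unfolding e t(2) by (simp add: algebra_simps)
  then have J: "cnj t * (?A + \<i> * ?J) = 0" using 1 by simp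
  have "t * (?A - \<i> * ?J) = th1 q v + \<i> * th1 q v'"
    unfolding e by (subst (1) t(1)) (simp add: algebra_simps)
  then have A: "t * (?A - \<i> * ?J) = 1" using 1 by simp
  then have "?A + \<i> * ?J = 0" using J by auto
  then show J': "?J = \<i> * ?A" by (auto simp: complex_eq_iff)
  show "?A \<noteq> 0" using A unfolding J' by auto
qed

lemma dtheta_real:
  assumes q: "q \<in> U" "Bf q q = 1" and v: "Bf q v = 0" and w: "Bf q w = 0"
  shows "\<i> * complex_of_real (h q) * (th1 q v * cnj (th1 q w) - th1 q w * cnj (th1 q v))
     = \<i> * complex_of_real (h0 q) * (th0 q v * cnj (th0 q w) - th0 q w * cnj (th0 q v))"
proof -
  have q0: "q \<noteq> 0" by (rule nonzero_on[OF q(2)])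
  have z: "th1 q 0 = 0" "\<theta> q 0 = 0" by (simp_all add: linear_0[OF linear_th1[OF q]] theta_eq du_def)
  have "capp2 (dform \<theta> q) (v, 0) (w, 0) = dform \<theta> q v w"
    by (rule capp2_real) (simp_all add: dtheta_structure[OF q0] v w linear_0[OF linear_th0])
  moreover have "cwedge (th1 q) (fconj th1 q) (v, 0) (w, 0) = th1 q v * cnj (th1 q w) - th1 q w * cnj (th1 q v)"
    by (subst cwedge_real) (simp_all add: fconj_def z)
  ultimately show ?thesis
    using dtheta_eq[OF q ctangent_real[OF v] ctangent_real[OF w]] dtheta_structure[OF q0 v w] by simp
qed

text \<open>Contraction of d\<open>\<theta>\<close> with \<open>T0\<close> vanishes by the explicit
  formula. Written in terms of \<open>th1\<close> and tested on \<open>V0\<close> and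
  \<open>JV0\<close>, this forces the value 0.\<close>

lemma th1_T0:
  assumes q: "q \<in> U" "Bf q q = 1"
  shows "th1 q (T0 q) = 0"
proof -
  have q0: "q \<noteq> 0" by (rule nonzero_on[OF q(2)])
  note fv = frame_values[OF q0] frame_values'[OF q0]
  let ?x = "th1 q (T0 q)" and ?A = "th1 q (V0 q)"
  have h: "h q \<noteq> 0" using h_pos[OF q] by simp
  have "?x * cnj ?A - ?A * cnj ?x = 0"
    using dtheta_real[OF q, of "T0 q" "V0 q"] h by (simp add: fv)
  moreover have "?x * cnj (\<i> * ?A) - \<i> * ?A * cnj ?x = 0"
    using dtheta_real[OF q, of "T0 q" "JV0 q"] h unfolding th1_horizontal(1)[OF q] by (simp add: fv)
  then have "- \<i> * (?x * cnj ?A + ?A * cnj ?x) = 0" by (simp add: algebra_simps)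
  then have "?x * cnj ?A + ?A * cnj ?x = 0" by simp
  ultimately have "2 * (?x * cnj ?A) = 0" by (simp add: algebra_simps)
  then show ?thesis using th1_horizontal(2)[OF q] by simp
qed

text \<open>For \<open>x\<close> on the ellipsoid this is \<open>th1 x (V0 x)\<close>, but \<open>th1 x\<close> need not be linear elsewhere
  and the sum is differentiable regardless.\<close>

definition lam :: "pt \<Rightarrow> complex" where "lam x = (\<Sum>e\<in>Basis. (V0 x \<bullet> e) *\<^sub>R th1 x e)"

definition lam' :: "pt \<Rightarrow> pt \<Rightarrow> complex" where "lam' q = frechet_derivative lam (at q)"

lemma lam_eq:
  assumes q: "q \<in> U" "Bf q q = 1"
  shows "lam q = th1 q (V0 q)"
  unfolding lam_def by (rule sum_Basis_linear[OF linear_th1[OF q], symmetric])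

text \<open>Both sides agree on \<open>T0\<close>, \<open>V0\<close> and \<open>JV0\<close>.\<close>

lemma th1_eq:
  assumes q: "q \<in> U" "Bf q q = 1" and v: "Bf q v = 0"
  shows "th1 q v = lam q * th0 q v"
proof -
  have q0: "q \<noteq> 0" by (rule nonzero_on[OF q(2)])
  have "th1 q v = th1 q (Re (\<theta> q v) *\<^sub>R T0 q + (Re (th0 q v) *\<^sub>R V0 q + Im (th0 q v) *\<^sub>R JV0 q))"
    using tangent_decomp[OF q0 v] by simp
  also have "\<dots> = lam q * (of_real (Re (th0 q v)) + \<i> * of_real (Im (th0 q v)))"
    unfolding linear_add[OF linear_th1[OF q]] linear_scale[OF linear_th1[OF q]] th1_T0[OF q]
      th1_horizontal(1)[OF q] lam_eq[OF q] scaleR_conv_of_real by (simp add: algebra_simps)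
  finally show ?thesis using complex_eq[of "th0 q v"] by simp
qed

lemma lam_nz: "q \<in> U \<Longrightarrow> Bf q q = 1 \<Longrightarrow> lam q \<noteq> 0"
  using th1_horizontal lam_eq by simp

text \<open>Compares the two formulas for d\<open>\<theta>\<close> on \<open>V0\<close> and
  \<open>JV0\<close>.\<close>

lemma h_lam:
  assumes q: "q \<in> U" "Bf q q = 1"
  shows "complex_of_real (h q) * (lam q * cnj (lam q)) = complex_of_real (h0 q)"
proof -
  have q0: "q \<noteq> 0" by (rule nonzero_on[OF q(2)])
  note fv = frame_values[OF q0] frame_values'[OF q0]
  show ?thesis
    using dtheta_real[OF q, of "V0 q" "JV0 q"]
    by (simp add: fv th1_eq[OF q] algebra_simps)
qed

lemma has_derivative_lam:
  assumes q: "q \<in> U" "q \<noteq> 0"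
  shows "(lam has_derivative lam' q) (at q)"
proof -
  have "(\<lambda>x. (u2 x * inverse (dd x), - u1 x * inverse (dd x))) differentiable (at q)"
  proof -
    have "C1_on (\<lambda>x. u2 x * inverse (dd x)) (- {0})" "C1_on (\<lambda>x. (0 - u1 x) * inverse (dd x)) (- {0})"
      by (intro C1_intros C1_on_inverse_dd)+
    from has_derivative_Pair[OF this[THEN C1_on_has_derivative, of q]] q(2) show ?thesis
      unfolding differentiable_def by auto
  qed
  then obtain D where D: "(V0 has_derivative D) (at q)"
    unfolding V0_def[abs_def] differentiable_def divide_inverse by blast
  have "(lam has_derivative (\<lambda>k. \<Sum>e\<in>Basis. (V0 q \<bullet> e) *\<^sub>R frechet_derivative (\<lambda>x. th1 x e) (at q) k
     + (D k \<bullet> e) *\<^sub>R th1 q e)) (at q)"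
    unfolding lam_def[abs_def]
    by (intro has_derivative_sum has_derivative_scaleR has_derivative_inner_left D
        C1_on_has_derivative[OF C1_th1] q)
  then have "lam differentiable (at q)" unfolding differentiable_def by blast
  then show ?thesis by (simp add: lam'_def frechet_derivative_works)
qed

lemma linear_lam': "q \<in> U \<Longrightarrow> q \<noteq> 0 \<Longrightarrow> linear (lam' q)"
  by (rule has_derivative_linear[OF has_derivative_lam])

lemma diff_th0: "(\<lambda>x. th0 x v) differentiable (at q)"
  using has_derivative_th0 unfolding differentiable_def by blast

lemma diff_om0: "q \<noteq> 0 \<Longrightarrow> (\<lambda>x. om0 x v) differentiable (at q)"
  using C1_on_om0 unfolding C1_on_def by blast

text \<open>\<open>th1\<close> minus \<open>lam\<close> times \<open>th0\<close> vanishes on tangent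
  vectors along the ellipsoid, hence so does its exterior derivative; then the Leibniz rule
  applies.\<close>

lemma dth1_lam:
  assumes q: "q \<in> U" "Bf q q = 1" and v: "Bf q v = 0" and w: "Bf q w = 0"
  shows "dform th1 q v w = lam' q v * th0 q w - lam' q w * th0 q v + lam q * dform th0 q v w"
proof -
  have q0: "q \<noteq> 0" by (rule nonzero_on[OF q(2)])
  have dl: "lam differentiable (at q)"
    using has_derivative_lam[OF q(1) q0] unfolding differentiable_def by blast
  have dlt: "(\<lambda>x. lam x * th0 x v) differentiable (at q)" for v
    by (intro differentiable_mult dl diff_th0)
  have "dform (\<lambda>x v. th1 x v - lam x * th0 x v) q v w = 0"
  proof (rule dform_eq_0_of_exact_on[where \<Lambda>="\<lambda>x. 0" and L="\<lambda>x v. 0", OF open_U q _ _ _ _ v w])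
    show "linear (\<lambda>v. th1 x v - lam x * th0 x v)" if "x \<in> U" "Bf x x = 1" for x
      by (intro linear_compose_sub linear_mult_left linear_th1 linear_th0 that)
    show "(\<lambda>x. th1 x e - lam x * th0 x e) differentiable (at q)" for e
      by (intro differentiable_diff dlt diff_th1 q)
    show "0 = th1 x v - lam x * th0 x v" if "x \<in> U" "Bf x x = 1" "Bf x v = 0" for x v
      using th1_eq[OF that] by simp
  qed simp
  then show ?thesis
    by (simp add: dform_diff[OF diff_th1[OF q(1)] dlt] dform_mult[OF has_derivative_lam[OF q(1) q0] diff_th0])
qed

lemma dth1_real:
  assumes q: "q \<in> U" "Bf q q = 1"
  obtains a where "\<And>v w. Bf q v = 0 \<Longrightarrow> Bf q w = 0 \<Longrightarrow>
      dform th1 q v w = th1 q v * om q w - th1 q w * om q v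
         + (\<theta> q v * (a * cnj (th1 q w)) - \<theta> q w * (a * cnj (th1 q v)))"
proof -
  have q0: "q \<noteq> 0" by (rule nonzero_on[OF q(2)])
  obtain a where a: "\<And>X. ctangent (ell_u A1 B1 A2 B2) q X \<Longrightarrow> capp (tau q) X = a * capp (fconj th1 q) X"
    using tau_eq[OF q] by blast
  have z: "th1 q 0 = 0" "\<theta> q 0 = 0" "om q 0 = 0" "tau q 0 = 0" "th0 q 0 = 0" "om0 q 0 = 0" "tau0 q 0 = 0" "lam' q 0 = 0"
    using linear_th1[OF q] linear_theta linear_om[OF q] linear_tau[OF q] linear_th0 linear_om0 linear_tau0
      linear_lam'[OF q(1) q0] by (simp_all add: linear_0)
  show thesis
  proof (rule that)
    fix v w assume v: "Bf q v = 0" and w: "Bf q w = 0"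
    have tau: "tau q v = a * cnj (th1 q v)" if "Bf q v = 0" for v
      using a[OF ctangent_real[OF that]] by (simp add: capp_def z fconj_def)
    \<comment> \<open>Off the ellipsoid \<open>th1 x 0\<close> may be nonzero, so the vanishing of
      \<open>dform th1 q\<close> at zero arguments is taken from \<open>dth1_lam\<close>.\<close>
    have "capp2 (dform th1 q) (v, 0) (w, 0) = dform th1 q v w"
      by (rule capp2_real) (simp_all add: dth1_lam[OF q] v w dth0_structure[OF q0] z)
    moreover have "cwedge (th1 q) (om q) (v, 0) (w, 0) = th1 q v * om q w - th1 q w * om q v"
      "cwedge (\<theta> q) (tau q) (v, 0) (w, 0) = \<theta> q v * tau q w - \<theta> q w * tau q v"
      by (simp_all add: cwedge_real z)
    ultimately show "dform th1 q v w = th1 q v * om q w - th1 q w * om q v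
         + (\<theta> q v * (a * cnj (th1 q w)) - \<theta> q w * (a * cnj (th1 q v)))"
      using dth1_eq[OF q ctangent_real[OF v] ctangent_real[OF w]] by (simp add: tau v w)
  qed
qed

text \<open>The defect in the transformation law by which \<open>om\<close> is \<open>om0\<close>
  minus the logarithmic differential of \<open>lam\<close>; it is shown to vanish on tangent
  vectors.\<close>

definition \<delta> :: "pt \<Rightarrow> pt \<Rightarrow> complex" where "\<delta> q v = lam' q v - lam q * (om0 q v - om q v)"

text \<open>Subtracting the two structure equations leaves \<open>\<delta>\<close> wedge
  \<open>th0\<close> plus a multiple of \<open>\<theta>\<close> wedge conjugate \<open>th0\<close>
  equal to 0. Hence \<open>\<delta>\<close> is a multiple of \<open>th0\<close> along the
  ellipsoid.\<close>

lemma delta_structure: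
  assumes q: "q \<in> U" "Bf q q = 1"
  shows "\<delta> q (T0 q) = 0" "\<delta> q (JV0 q) = \<i> * \<delta> q (V0 q)"
proof -
  have q0: "q \<noteq> 0" by (rule nonzero_on[OF q(2)])
  note fv = frame_values[OF q0] frame_values'[OF q0]
  note fv2 = fv(7,8,9)
  obtain a where a: "\<And>v w. Bf q v = 0 \<Longrightarrow> Bf q w = 0 \<Longrightarrow>
      dform th1 q v w = th1 q v * om q w - th1 q w * om q v
         + (\<theta> q v * (a * cnj (th1 q w)) - \<theta> q w * (a * cnj (th1 q v)))"
    using dth1_real[OF q] by blast
  have main: "lam' q v * th0 q w - lam' q w * th0 q v
      + lam q * (th0 q v * om0 q w - th0 q w * om0 q v + (\<theta> q v * tau0 q w - \<theta> q w * tau0 q v))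
    = lam q * th0 q v * om q w - lam q * th0 q w * om q v
         + (\<theta> q v * (a * cnj (lam q * th0 q w)) - \<theta> q w * (a * cnj (lam q * th0 q v)))"
    if v: "Bf q v = 0" and w: "Bf q w = 0" for v w
    using a[OF v w] unfolding dth1_lam[OF q v w] dth0_structure[OF q0 v w] th1_eq[OF q v] th1_eq[OF q w] .
  \<comment> \<open>The coefficient of \<open>\<theta>\<close> wedge conjugate \<open>th0\<close>.
    Pairing \<open>T0\<close> with \<open>V0\<close> and with \<open>JV0\<close> brings it in with
    opposite signs.\<close>
  let ?c = "lam q * tau_coeff q - a * cnj (lam q)"
  have 1: "\<delta> q (T0 q) + ?c = 0"
    using main[OF fv2(1,2)] unfolding fv tau0_def by (simp add: \<delta>_def algebra_simps)
  have "\<i> * (\<delta> q (T0 q) - ?c) = 0"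
    using main[OF fv2(1,3)] unfolding fv tau0_def by (simp add: \<delta>_def algebra_simps)
  then have 2: "\<delta> q (T0 q) - ?c = 0" by simp
  have "2 * \<delta> q (T0 q) = (\<delta> q (T0 q) + ?c) + (\<delta> q (T0 q) - ?c)" by simp
  then have "2 * \<delta> q (T0 q) = 0" unfolding 1 2 by simp
  then show "\<delta> q (T0 q) = 0" by simp
  show "\<delta> q (JV0 q) = \<i> * \<delta> q (V0 q)"
    using main[OF fv2(2,3)] unfolding fv by (simp add: \<delta>_def algebra_simps)
qed

text \<open>Logarithmic differentiation of \<open>h_lam\<close>, combined with the reality
  conditions on \<open>om\<close> and \<open>om0\<close>.\<close>

lemma delta_imaginary:
  assumes q: "q \<in> U" "Bf q q = 1" and v: "Bf q v = 0"
  shows "\<delta> q v / lam q + cnj (\<delta> q v / lam q) = 0"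
proof -
  have q0: "q \<noteq> 0" by (rule nonzero_on[OF q(2)])
  have z: "om q 0 = 0" using linear_om[OF q] by (simp add: linear_0)
  have dh0: "frechet_derivative h (at q) 0 = 0"
    by (rule linear_0[OF has_derivative_linear[OF C1_on_has_derivative[OF C1_h q(1)]]])
  have o: "om q v + cnj (om q v) = complex_of_real (frechet_derivative h (at q) v / h q)"
    using om_eq[OF q ctangent_real[OF v]] by (simp add: capp_def fconj_def z dh0)
  let ?h' = "complex_of_real (frechet_derivative h (at q) v)"
  let ?k' = "complex_of_real (frechet_derivative h0 (at q) v)"
  let ?L = "lam q" and ?L' = "lam' q v" and ?h = "complex_of_real (h q)"
  note l = has_derivative_lam[OF q(1) q0]
  have "h0 differentiable (at q)" using C1_on_h0 q0 unfolding C1_on_def by simp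
  then have k: "(h0 has_derivative frechet_derivative h0 (at q)) (at q)"
    by (simp add: frechet_derivative_works)
  have F: "((\<lambda>x. complex_of_real (h x) * (lam x * cnj (lam x)) - complex_of_real (h0 x)) has_derivative
    (\<lambda>v. (of_real (h q) * (lam q * cnj (lam' q v) + lam' q v * cnj (lam q))
       + of_real (frechet_derivative h (at q) v) * (lam q * cnj (lam q)))
       - of_real (frechet_derivative h0 (at q) v))) (at q)"
    by (intro has_derivative_diff has_derivative_mult has_derivative_cnj l
        bounded_linear.has_derivative[OF bounded_linear_of_real] k C1_on_has_derivative[OF C1_h q(1)])
  \<comment> \<open>\<open>h_lam\<close> holds only on the ellipsoid, so it may be differentiated
    only in tangent directions.\<close>
  have "(?h * (?L * cnj ?L' + ?L' * cnj ?L) + ?h' * (?L * cnj ?L)) - ?k' = 0"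
    by (rule derivative_zero_of_zero_on[OF open_U q F _ v]) (simp add: h_lam)
  then have k': "?k' = ?h * (?L * cnj ?L' + ?L' * cnj ?L) + ?h' * (?L * cnj ?L)" by simp
  have nz: "?h \<noteq> 0" "?L \<noteq> 0" "cnj ?L \<noteq> 0" using h_pos[OF q] lam_nz[OF q] by simp_all
  have "om0 q v + cnj (om0 q v) = ?k' / complex_of_real (h0 q)"
    using om0_real_part[OF q0 v] by simp
  also have "\<dots> = cnj ?L' / cnj ?L + ?L' / ?L + ?h' / ?h"
    unfolding h_lam[OF q, symmetric] k' using nz by (simp add: field_simps)
  finally have e: "om0 q v + cnj (om0 q v) = cnj ?L' / cnj ?L + ?L' / ?L + ?h' / ?h" .
  have d: "\<delta> q v / ?L = ?L' / ?L - om0 q v + om q v"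
    using nz by (simp add: \<delta>_def field_simps)
  have "\<delta> q v / ?L + cnj (\<delta> q v / ?L) = (cnj ?L' / cnj ?L + ?L' / ?L)
      - (om0 q v + cnj (om0 q v)) + (om q v + cnj (om q v))"
    unfolding d by simp
  then show ?thesis unfolding e o by simp
qed

lemma lam'_eq:
  assumes q: "q \<in> U" "Bf q q = 1" and v: "Bf q v = 0"
  shows "lam' q v = lam q * (om0 q v - om q v)"
proof -
  have q0: "q \<noteq> 0" by (rule nonzero_on[OF q(2)])
  note fv = frame_values'[OF q0]
  define k where "k = \<delta> q (V0 q) / lam q"
  have k1: "k + cnj k = 0" unfolding k_def by (rule delta_imaginary[OF q fv(2)])
  \<comment> \<open>Both \<open>k\<close> and \<open>\<i> * k\<close> are purely imaginary, which
    forces \<open>k\<close> to be 0.\<close>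
  have "\<delta> q (JV0 q) / lam q = \<i> * k" by (simp add: k_def delta_structure(2)[OF q])
  then have "\<i> * k + cnj (\<i> * k) = 0" using delta_imaginary[OF q fv(3)] by simp
  with k1 have "k = 0" by (simp add: complex_eq_iff)
  then have V: "\<delta> q (V0 q) = 0" using lam_nz[OF q] by (simp add: k_def)
  have lin: "linear (\<delta> q)"
    unfolding \<delta>_def[abs_def]
    by (intro linear_compose_sub linear_mult_left linear_lam'[OF q(1) q0] linear_om0 linear_om[OF q])
  have "\<delta> q v = \<delta> q (Re (\<theta> q v) *\<^sub>R T0 q + (Re (th0 q v) *\<^sub>R V0 q + Im (th0 q v) *\<^sub>R JV0 q))"
    using tangent_decomp[OF q0 v] by simp
  also have "\<dots> = 0"
    by (simp add: linear_add[OF lin] linear_scale[OF lin] delta_structure[OF q] V)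
  finally show ?thesis by (simp add: \<delta>_def)
qed

text \<open>By \<open>lam'_eq\<close>, \<open>lam\<close> times the difference of the connection
  forms is the differential of \<open>lam\<close> along the ellipsoid, hence closed there.\<close>

lemma dom_eq:
  assumes q: "q \<in> U" "Bf q q = 1" and v: "Bf q v = 0" and w: "Bf q w = 0"
  shows "dform om q v w = dform om0 q v w"
proof -
  have q0: "q \<noteq> 0" by (rule nonzero_on[OF q(2)])
  have dl: "lam differentiable (at q)"
    using has_derivative_lam[OF q(1) q0] unfolding differentiable_def by blast
  have d: "(\<lambda>x. om0 x v - om x v) differentiable (at q)" for v
    by (intro differentiable_diff diff_om0 diff_om q q0)
  have "dform (\<lambda>x v. lam x * (om0 x v - om x v)) q v w = 0"
  proof (rule dform_eq_0_of_exact_on[where \<Lambda>=lam and L=lam', OF open_U q _ _ _ _ v w])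
    show "linear (\<lambda>v. lam x * (om0 x v - om x v))" if "x \<in> U" "Bf x x = 1" for x
      by (intro linear_compose_sub linear_mult_left linear_om0 linear_om that)
    show "(\<lambda>x. lam x * (om0 x e - om x e)) differentiable (at q)" for e
      by (intro differentiable_mult dl d)
    show "(lam has_derivative lam' x) (at x)" if "x \<in> U" "Bf x x = 1" for x
      using has_derivative_lam[OF that(1) nonzero_on[OF that(2)]] .
  qed (rule lam'_eq)
  then have "lam' q v * (om0 q w - om q w) - lam' q w * (om0 q v - om q v)
      + lam q * (dform om0 q v w - dform om q v w) = 0"
    by (simp add: dform_mult[OF has_derivative_lam[OF q(1) q0] d] dform_diff[OF diff_om0[OF q0] diff_om[OF q(1)]])
  \<comment> \<open>After substituting \<open>lam'_eq\<close>, the first two terms are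
    \<open>lam\<close> times the wedge of \<open>om0\<close> minus \<open>om\<close> with itself,
    and cancel.\<close>
  then show ?thesis
    using lam_nz[OF q] unfolding lam'_eq[OF q v] lam'_eq[OF q w] by simp
qed

text \<open>Evaluation on \<open>V0\<close> and \<open>JV0\<close> removes the term with
  \<open>\<theta>\<close>. There d\<open>om\<close> equals d\<open>om0\<close>, and
  \<open>h_lam\<close> matches the normalizations of the two coframes.\<close>

lemma TW_curv_unique:
  assumes q: "q \<in> U" "Bf q q = 1" and r: "TW_curv A1 B1 A2 B2 th1 h om q r"
  shows "r = curv q"
proof -
  have q0: "q \<noteq> 0" by (rule nonzero_on[OF q(2)])
  have nz: "dd q \<noteq> 0" by (rule dd_nz[OF q0])
  note fv = frame_values[OF q0] frame_values'[OF q0]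
  note fv2 = fv(8,9)
  obtain \<sigma> where \<sigma>: "linear \<sigma>" and eq: "\<And>X Y. ctangent (ell_u A1 B1 A2 B2) q X \<Longrightarrow> ctangent (ell_u A1 B1 A2 B2) q Y \<Longrightarrow>
         capp2 (dform om q) X Y - r * complex_of_real (h q) * cwedge (th1 q) (fconj th1 q) X Y
           = cwedge (\<theta> q) \<sigma> X Y"
    using r unfolding TW_curv_def by blast
  have z: "th1 q 0 = 0" "\<theta> q 0 = 0" "\<sigma> 0 = 0"
    using linear_th1[OF q] linear_theta \<sigma> by (simp_all add: linear_0)
  have om0_0: "dform om0 q v 0 = 0" "dform om0 q 0 v = 0" for v
  proof -
    have "frechet_derivative (\<lambda>x. om0 x v) (at q) 0 = 0"
      by (rule linear_0[OF has_derivative_linear[OF frechet_derivative_works[THEN iffD1, OF diff_om0[OF q0]]]])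
    then show "dform om0 q v 0 = 0" "dform om0 q 0 v = 0"
      by (simp_all add: dform_def linear_0[OF linear_om0])
  qed
  have "capp2 (dform om q) (V0 q, 0) (JV0 q, 0) = dform om q (V0 q) (JV0 q)"
    by (rule capp2_real) (simp_all add: dom_eq[OF q] fv om0_0)
  also have "\<dots> = - 2 * \<i> * curv q / dd q"
    unfolding dom_eq[OF q fv2] by (rule dom0_frame[OF q0])
  finally have 1: "capp2 (dform om q) (V0 q, 0) (JV0 q, 0) = - 2 * \<i> * curv q / dd q" .
  have "cwedge (th1 q) (fconj th1 q) (V0 q, 0) (JV0 q, 0) = - 2 * \<i> * (lam q * cnj (lam q))"
    by (subst cwedge_real) (simp_all add: fconj_def z th1_eq[OF q fv2(1)] th1_eq[OF q fv2(2)] fv)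
  moreover have "cwedge (\<theta> q) \<sigma> (V0 q, 0) (JV0 q, 0) = 0"
    by (subst cwedge_real) (simp_all add: z fv)
  ultimately have "- 2 * \<i> * curv q / dd q = r * complex_of_real (h q) * (- 2 * \<i> * (lam q * cnj (lam q)))"
    using eq[OF ctangent_real[OF fv2(1)] ctangent_real[OF fv2(2)]] 1 by simp
  also have "\<dots> = - 2 * \<i> * r * (complex_of_real (h q) * (lam q * cnj (lam q)))" by simp
  also have "\<dots> = - 2 * \<i> * r / dd q" unfolding h_lam[OF q] h0_eq by (simp add: divide_inverse)
  finally show ?thesis using nz by simp
qed

end

section \<open>Existence of the data and positivity of every curvature value\<close>

theorem mainTheorem4:
  fixes A1 B1 A2 B2 :: real and p :: pt
  assumes "A1 > 0" "B1 > 0" "A2 > 0" "B2 > 0"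
    and "p \<in> ellipsoid A1 B1 A2 B2"
  shows "(\<exists>U Z T th1 h om tau r. p \<in> U \<and> TW_data A1 B1 A2 B2 U Z T th1 h om tau \<and>
            TW_curv A1 B1 A2 B2 th1 h om p r) \<and>
         (\<forall>U Z T th1 h om tau r. p \<in> U \<and> TW_data A1 B1 A2 B2 U Z T th1 h om tau \<and>
            TW_curv A1 B1 A2 B2 th1 h om p r \<longrightarrow> (\<exists>R::real. R > 0 \<and> r = complex_of_real R))"
proof -
  interpret ell A1 B1 A2 B2 using assms by unfold_locales
  have p: "Bf p p = 1" using assms(5) by (simp add: mem_ellipsoid)
  then have p0: "p \<noteq> 0" by (rule nonzero_on)
  then have pU: "p \<in> - {0}" by simp
  show ?thesis
  proof (intro conjI allI impI; (elim conjE)?)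
    show "\<exists>U Z T th1 h om tau r. p \<in> U \<and> TW_data A1 B1 A2 B2 U Z T th1 h om tau \<and>
            TW_curv A1 B1 A2 B2 th1 h om p r"
      by (intro exI conjI) (rule pU TW_data_explicit TW_curv_explicit[OF p])+
  next
    fix U Z T th1 h om tau r
    assume U: "p \<in> U" and d: "TW_data A1 B1 A2 B2 U Z T th1 h om tau"
      and c: "TW_curv A1 B1 A2 B2 th1 h om p r"
    interpret tw A1 B1 A2 B2 U Z T th1 h om tau using d by unfold_locales
    show "\<exists>R::real. R > 0 \<and> r = complex_of_real R"
      using TW_curv_unique[OF U p c] curv_pos[OF p0] by simp
  qed
qed

end
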